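(* Fix $h>0$. The problem of finding masks such that the associated operator $\mathcal{Q}$, $f\mapsto Qf$ (defined in the context), satisfies both (i) $Qf\in S_3^1(\Delta_3)$ for every $f\in C^1(\mathbb{R}^2)$, and (ii) $\mathcal{Q}$ is exact on $\mathbb{P}_2$, i.e. $\mathcal{Q}[p]=p$ for every bivariate polynomial $p$ of total degree at most $2$, has a 5-parametric family of solutions; that is, the set of all tuples of masks in $(\mathbb{R}^7)^{27}$ satisfying (i) and (ii) is an affine subspace of dimension $5$.
   Context: Triangulation. For $h>0$ let $e_1=(h,h)$, $e_2=(h,-h)$ and $v_{i,j}=ie_1+je_2$, $i,j\in\mathbb{Z}$. The uniform three-direction triangulation $\Delta_3$ of $\mathbb{R}^2$ consists of the triangles $T_{i,j}=[v_{i,j},v_{i+1,j+1},v_{i+1,j}]$ and $\widetilde T_{i,j}=[v_{i,j},v_{i+1,j+1},v_{i,j+1}]$, $i,j\in\mathbb{Z}$. $S_3^1(\Delta_3)$ is the space of $C^1$ functions on $\mathbb{R}^2$ whose restriction to each triangle of $\Delta_3$ is a polynomial of total degree at most $3$. Bernstein polynomials. For a triangle with ordered vertices $(w_1,w_2,w_3)$ and barycentric coordinates $(\tau_1,\tau_2,\tau_3)$ with respect to it, $B_{\alpha_1,\alpha_2,\alpha_3}=\frac{3!}{\alpha_1!\alpha_2!\alpha_3!}\tau_1^{\alpha_1}\tau_2^{\alpha_2}\tau_3^{\alpha_3}$, $\alpha_1+\alpha_2+\alpha_3=3$. For $T_{i,j}$ the vertices are ordered as $(v_{i,j},v_{i+1,j+1},v_{i+1,j})$,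 and for $\widetilde T_{i,j}$ as $(v_{i,j+1},v_{i+1,j+1},v_{i,j})$. Masks. For a function $g$ on $\mathbb{R}^2$ put $g_{i,j}=(g(v_{i,j}),g(v_{i+1,j+1}),g(v_{i+1,j}),g(v_{i,j-1}),g(v_{i-1,j-1}),g(v_{i-1,j}),g(v_{i,j+1}))\in\mathbb{R}^7$. Masks are vectors in $\mathbb{R}^7$ with entries indexed $0,\dots,6$; the product of a mask and such a vector is the Euclidean inner product. Let $K=\{(k,m)\in\{-1,0,1\}^2: k+m\neq 0\}$ (six pairs). Given the 27 masks $\alpha_{0,0},\alpha_{1,0},\alpha_{0,1}$; $\beta^{k,m}_{0,0},\beta^{k,m}_{1,0},\beta^{k,m}_{0,1}$ for $(k,m)\in K$; $\gamma_{0,0},\gamma_{1,0},\gamma_{0,1}$; $\widetilde\gamma_{0,0},\widetilde\gamma_{1,0},\widetilde\gamma_{0,1}$, define for $f\in C^1(\mathbb{R}^2)$ and $i,j\in\mathbb{Z}$, with $\partial_{1,0}f,\partial_{0,1}f$ the partial derivatives in $x$ and $y$, $$V_{i,j}=\alpha_{0,0}f_{i,j}+\alpha_{1,0}\,h\,\partial_{1,0}f_{i,j}+\alpha_{0,1}\,h\,\partial_{0,1}f_{i,j},\qquad U^{k,m}_{i,j}=\beta^{k,m}_{0,0}f_{i,j}+\beta^{k,m}_{1,0}\,h\,\partial_{1,0}f_{i,j}+\beta^{k,m}_{0,1}\,h\,\partial_{0,1}f_{i,j},$$ $$C_{i,j}=\gamma_{0,0}f_{i,j}+\gamma_{1,0}\,h\,\partial_{1,0}f_{i,j}+\gamma_{0,1}\,h\,\partial_{0,1}f_{i,j},\qquad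 \widetilde C_{i,j}=\widetilde\gamma_{0,0}f_{i,j}+\widetilde\gamma_{1,0}\,h\,\partial_{1,0}f_{i,j}+\widetilde\gamma_{0,1}\,h\,\partial_{0,1}f_{i,j}.$$ Operator. $Qf=\mathcal{Q}[f]$ is the continuous piecewise cubic function on $\Delta_3$ given by $$Qf|_{T_{i,j}}=V_{i,j}B_{3,0,0}+U_{i,j}^{1,1}B_{2,1,0}+U_{i,j}^{1,0}B_{2,0,1}+U_{i+1,j+1}^{-1,-1}B_{1,2,0}+C_{i,j}B_{1,1,1}+U_{i+1,j}^{-1,0}B_{1,0,2}+V_{i+1,j+1}B_{0,3,0}+U_{i+1,j+1}^{0,-1}B_{0,2,1}+U_{i+1,j}^{0,1}B_{0,1,2}+V_{i+1,j}B_{0,0,3},$$ $$Qf|_{\widetilde T_{i,j}}=V_{i,j+1}B_{3,0,0}+U_{i,j+1}^{1,0}B_{2,1,0}+U_{i,j+1}^{0,-1}B_{2,0,1}+U_{i+1,j+1}^{-1,0}B_{1,2,0}+\widetilde C_{i,j}B_{1,1,1}+U_{i,j}^{0,1}B_{1,0,2}+V_{i+1,j+1}B_{0,3,0}+U_{i+1,j+1}^{-1,-1}B_{0,2,1}+U_{i,j}^{1,1}B_{0,1,2}+V_{i,j}B_{0,0,3},$$ where the Bernstein polynomials are those of the triangle in question with the vertex order fixed above. *)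

theory Defs
  imports "HOL-Analysis.Analysis"
begin

definition vtx :: "real \<Rightarrow> int \<Rightarrow> int \<Rightarrow> real \<times> real" where
  "vtx h i j = of_int i *\<^sub>R (h, h) + of_int j *\<^sub>R (h, - h)"

definition tri :: "real \<Rightarrow> int \<Rightarrow> int \<Rightarrow> (real \<times> real) set" where
  "tri h i j = convex hull {vtx h i j, vtx h (i+1) (j+1), vtx h (i+1) j}"

definition tri' :: "real \<Rightarrow> int \<Rightarrow> int \<Rightarrow> (real \<times> real) set" where
  "tri' h i j = convex hull {vtx h i j, vtx h (i+1) (j+1), vtx h i (j+1)}"

definition poly2_deg_le :: "nat \<Rightarrow> (real \<times> real \<Rightarrow> real) \<Rightarrow> bool" where
  "poly2_deg_le d p \<longleftrightarrow>
     (\<exists>c :: nat \<Rightarrow> nat \<Rightarrow> real. \<forall>x y. p (x, y) = (\<Sum>a\<le>d. \<Sum>b\<le>d - a. c a b * x ^ a * y ^ b))"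

definition C1_plane :: "(real \<times> real \<Rightarrow> real) \<Rightarrow> bool" where
  "C1_plane f \<longleftrightarrow> (\<exists>D :: real \<times> real \<Rightarrow> (real \<times> real) \<Rightarrow>\<^sub>L real.
     (\<forall>p. (f has_derivative blinfun_apply (D p)) (at p)) \<and> continuous_on UNIV D)"

definition spline31 :: "real \<Rightarrow> (real \<times> real \<Rightarrow> real) set" where
  "spline31 h = {s. C1_plane s \<and>
     (\<forall>i j. (\<exists>p. poly2_deg_le 3 p \<and> (\<forall>z\<in>tri h i j. s z = p z)) \<and>
            (\<exists>p. poly2_deg_le 3 p \<and> (\<forall>z\<in>tri' h i j. s z = p z)))}"

definition area2 :: "real \<times> real \<Rightarrow> real \<times> real \<Rightarrow> real \<times> real \<Rightarrow> real" where
  "area2 a b c = (fst b - fst a) * (snd c - snd a) - (snd b - snd a) * (fst c - fst a)"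

text \<open>Barycentric coordinates as quotients of signed areas (Cramer's rule).\<close>

definition bary1 where "bary1 w1 w2 w3 p = area2 p w2 w3 / area2 w1 w2 w3"
definition bary2 where "bary2 w1 w2 w3 p = area2 w1 p w3 / area2 w1 w2 w3"
definition bary3 where "bary3 w1 w2 w3 p = area2 w1 w2 p / area2 w1 w2 w3"

lemma barycentric_coordinates:
  assumes "area2 w1 w2 w3 \<noteq> 0"
  shows "t1 + t2 + t3 = 1 \<and> t1 *\<^sub>R w1 + t2 *\<^sub>R w2 + t3 *\<^sub>R w3 = p \<longleftrightarrow>
         t1 = bary1 w1 w2 w3 p \<and> t2 = bary2 w1 w2 w3 p \<and> t3 = bary3 w1 w2 w3 p"
proof -
  obtain a b where w1: "w1 = (a, b)" by fastforce
  obtain c d where w2: "w2 = (c, d)" by fastforce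
  obtain e f where w3: "w3 = (e, f)" by fastforce
  obtain x y where p: "p = (x, y)" by fastforce
  have D: "(c - a) * (f - b) - (d - b) * (e - a) \<noteq> 0" (is "?D \<noteq> 0")
    using assms by (simp add: w1 w2 w3 area2_def)
  show ?thesis
  proof
    assume A: "t1 + t2 + t3 = 1 \<and> t1 *\<^sub>R w1 + t2 *\<^sub>R w2 + t3 *\<^sub>R w3 = p"
    then have t1: "t1 = 1 - t2 - t3" and x: "x = t1 * a + t2 * c + t3 * e"
      and y: "y = t1 * b + t2 * d + t3 * f"
      by (auto simp: w1 w2 w3 p)
    show "t1 = bary1 w1 w2 w3 p \<and> t2 = bary2 w1 w2 w3 p \<and> t3 = bary3 w1 w2 w3 p"
      unfolding bary1_def bary2_def bary3_def using assms
      by (simp add: nonzero_eq_divide_eq)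
         (simp add: w1 w2 w3 p area2_def x y t1 algebra_simps)
  next
    assume A: "t1 = bary1 w1 w2 w3 p \<and> t2 = bary2 w1 w2 w3 p \<and> t3 = bary3 w1 w2 w3 p"
    have m: "t1 * ?D = area2 p w2 w3" "t2 * ?D = area2 w1 p w3" "t3 * ?D = area2 w1 w2 p"
      using A D by (simp_all add: bary1_def bary2_def bary3_def w1 w2 w3 area2_def)
    have "(t1 + t2 + t3) * ?D = 1 * ?D"
      unfolding distrib_right m by (simp add: w1 w2 w3 p area2_def algebra_simps)
    moreover have "(t1 * a + t2 * c + t3 * e) * ?D = x * ?D"
    proof -
      have "(t1 * a + t2 * c + t3 * e) * ?D = a * (t1 * ?D) + c * (t2 * ?D) + e * (t3 * ?D)"
        by (simp add: algebra_simps)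
      then show ?thesis unfolding m by (simp add: w1 w2 w3 p area2_def algebra_simps)
    qed
    moreover have "(t1 * b + t2 * d + t3 * f) * ?D = y * ?D"
    proof -
      have "(t1 * b + t2 * d + t3 * f) * ?D = b * (t1 * ?D) + d * (t2 * ?D) + f * (t3 * ?D)"
        by (simp add: algebra_simps)
      then show ?thesis unfolding m by (simp add: w1 w2 w3 p area2_def algebra_simps)
    qed
    ultimately show "t1 + t2 + t3 = 1 \<and> t1 *\<^sub>R w1 + t2 *\<^sub>R w2 + t3 *\<^sub>R w3 = p"
      using D by (simp add: w1 w2 w3 p)
  qed
qed

definition bernstein3 ::
  "real \<times> real \<Rightarrow> real \<times> real \<Rightarrow> real \<times> real \<Rightarrow> nat \<Rightarrow> nat \<Rightarrow> nat \<Rightarrow> real \<times> real \<Rightarrow> real" where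
  "bernstein3 w1 w2 w3 a b c p =
     fact 3 / (fact a * fact b * fact c) *
     bary1 w1 w2 w3 p ^ a * bary2 w1 w2 w3 p ^ b * bary3 w1 w2 w3 p ^ c"

text \<open>A superscript $(k,m)$ is spelled by the signs of $k$ and $m$:
  \<open>P\<close> for $1$, \<open>Z\<close> for $0$, \<open>N\<close> for $-1$.\<close>

datatype direction = PP | PZ | ZP | NZ | ZN | NN

fun dir_vec :: "direction \<Rightarrow> int \<times> int" where
  "dir_vec PP = (1, 1)" | "dir_vec PZ = (1, 0)" | "dir_vec ZP = (0, 1)" |
  "dir_vec NZ = (-1, 0)" | "dir_vec ZN = (0, -1)" | "dir_vec NN = (-1, -1)"

lemma bij_betw_dir_vec:
  "bij_betw dir_vec UNIV {(k, m). k \<in> {-1, 0, 1} \<and> m \<in> {-1, 0, 1} \<and> k + m \<noteq> 0}"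
proof -
  have "inj dir_vec"
  proof (rule injI)
    fix x y assume "dir_vec x = dir_vec y"
    then show "x = y" by (cases x; cases y) simp_all
  qed
  moreover have U: "UNIV = {PP, PZ, ZP, NZ, ZN, NN}"
    using direction.exhaust by auto
  have "range dir_vec = {(k, m). k \<in> {-1, 0, 1} \<and> m \<in> {-1, 0, 1} \<and> k + m \<noteq> 0}"
    unfolding U by auto
  ultimately show ?thesis by (simp add: bij_betw_def)
qed

text \<open>\<open>Vert\<close>, \<open>Edge\<close>, \<open>Cen\<close>, \<open>Cen'\<close> index the masks $\alpha$, $\beta$, $\gamma$,
  $\widetilde\gamma$; the second index is the subscript $(0,0)$, $(1,0)$ or $(0,1)$.\<close>

datatype coefficient = Vert | Edge direction | Cen | Cen'

datatype jet = J00 | J10 | J01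

instance direction :: finite
proof
  have "(UNIV :: direction set) = {PP, PZ, ZP, NZ, ZN, NN}"
    using direction.exhaust by auto
  then show "finite (UNIV :: direction set)" by (metis finite.emptyI finite.insertI)
qed

instance coefficient :: finite
proof
  have "x \<in> {Vert, Cen, Cen'} \<union> range Edge" for x
    by (cases x) auto
  then have "(UNIV :: coefficient set) = {Vert, Cen, Cen'} \<union> range Edge"
    by blast
  then show "finite (UNIV :: coefficient set)"
    by (metis finite_Un finite.emptyI finite.insertI finite_imageI finite)
qed

instance jet :: finite
proof
  have "(UNIV :: jet set) = {J00, J10, J01}"
    using jet.exhaust by auto
  then show "finite (UNIV :: jet set)" by (metis finite.emptyI finite.insertI)
qed

type_synonym masks = "real ^ 7 ^ (coefficient \<times> jet)"

definition stencil :: "real \<Rightarrow> (real \<times> real \<Rightarrow> real) \<Rightarrow> int \<Rightarrow> int \<Rightarrow> real ^ 7" where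
  "stencil h g i j = (\<chi> k.
     if k = 0 then g (vtx h i j)
     else if k = 1 then g (vtx h (i+1) (j+1))
     else if k = 2 then g (vtx h (i+1) j)
     else if k = 3 then g (vtx h i (j-1))
     else if k = 4 then g (vtx h (i-1) (j-1))
     else if k = 5 then g (vtx h (i-1) j)
     else g (vtx h i (j+1)))"

definition partial_x :: "(real \<times> real \<Rightarrow> real) \<Rightarrow> real \<times> real \<Rightarrow> real" where
  "partial_x f p = deriv (\<lambda>t. f (t, snd p)) (fst p)"

definition partial_y :: "(real \<times> real \<Rightarrow> real) \<Rightarrow> real \<times> real \<Rightarrow> real" where
  "partial_y f p = deriv (\<lambda>t. f (fst p, t)) (snd p)"

definition bb_coeff ::
  "real \<Rightarrow> masks \<Rightarrow> (real \<times> real \<Rightarrow> real) \<Rightarrow> coefficient \<Rightarrow> int \<Rightarrow> int \<Rightarrow> real" where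
  "bb_coeff h M f c i j =
     M $ (c, J00) \<bullet> stencil h f i j
     + M $ (c, J10) \<bullet> (h *\<^sub>R stencil h (partial_x f) i j)
     + M $ (c, J01) \<bullet> (h *\<^sub>R stencil h (partial_y f) i j)"

definition bb_tri ::
  "real \<Rightarrow> masks \<Rightarrow> (real \<times> real \<Rightarrow> real) \<Rightarrow> int \<Rightarrow> int \<Rightarrow> real \<times> real \<Rightarrow> real" where
  "bb_tri h M f i j p =
    (let B = (\<lambda>a b c. bernstein3 (vtx h i j) (vtx h (i+1) (j+1)) (vtx h (i+1) j) a b c p);
         V = bb_coeff h M f Vert;
         U = (\<lambda>d. bb_coeff h M f (Edge d));
         C = bb_coeff h M f Cen
     in V i j * B 3 0 0 + U PP i j * B 2 1 0 + U PZ i j * B 2 0 1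
      + U NN (i+1) (j+1) * B 1 2 0 + C i j * B 1 1 1 + U NZ (i+1) j * B 1 0 2
      + V (i+1) (j+1) * B 0 3 0 + U ZN (i+1) (j+1) * B 0 2 1
      + U ZP (i+1) j * B 0 1 2 + V (i+1) j * B 0 0 3)"

definition bb_tri' ::
  "real \<Rightarrow> masks \<Rightarrow> (real \<times> real \<Rightarrow> real) \<Rightarrow> int \<Rightarrow> int \<Rightarrow> real \<times> real \<Rightarrow> real" where
  "bb_tri' h M f i j p =
    (let B = (\<lambda>a b c. bernstein3 (vtx h i (j+1)) (vtx h (i+1) (j+1)) (vtx h i j) a b c p);
         V = bb_coeff h M f Vert;
         U = (\<lambda>d. bb_coeff h M f (Edge d));
         C' = bb_coeff h M f Cen'
     in V i (j+1) * B 3 0 0 + U PZ i (j+1) * B 2 1 0 + U ZN i (j+1) * B 2 0 1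
      + U NZ (i+1) (j+1) * B 1 2 0 + C' i j * B 1 1 1 + U ZP i j * B 1 0 2
      + V (i+1) (j+1) * B 0 3 0 + U NN (i+1) (j+1) * B 0 2 1
      + U PP i j * B 0 1 2 + V i j * B 0 0 3)"

definition is_quasi_interpolant ::
  "real \<Rightarrow> masks \<Rightarrow> (real \<times> real \<Rightarrow> real) \<Rightarrow> (real \<times> real \<Rightarrow> real) \<Rightarrow> bool" where
  "is_quasi_interpolant h M f q \<longleftrightarrow>
     (\<forall>i j. (\<forall>p\<in>tri h i j. q p = bb_tri h M f i j p) \<and>
            (\<forall>p\<in>tri' h i j. q p = bb_tri' h M f i j p))"

definition quasi_interp ::
  "real \<Rightarrow> masks \<Rightarrow> (real \<times> real \<Rightarrow> real) \<Rightarrow> real \<times> real \<Rightarrow> real" where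
  "quasi_interp h M f = (THE q. is_quasi_interpolant h M f q)"

text \<open>The local formulas agree on common edges and the triangles cover the plane, so the
  description above determines exactly one function.\<close>

definition lat :: "real \<Rightarrow> real \<Rightarrow> real \<Rightarrow> real \<times> real" where
  "lat h s t = s *\<^sub>R (h, h) + t *\<^sub>R (h, - h)"

lemma bary_tri:
  assumes "h > 0"
  shows "bary1 (vtx h i j) (vtx h (i+1) (j+1)) (vtx h (i+1) j) (lat h (of_int i + u) (of_int j + w)) = 1 - u"
    and "bary2 (vtx h i j) (vtx h (i+1) (j+1)) (vtx h (i+1) j) (lat h (of_int i + u) (of_int j + w)) = w"
    and "bary3 (vtx h i j) (vtx h (i+1) (j+1)) (vtx h (i+1) j) (lat h (of_int i + u) (of_int j + w)) = u - w"
proof -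
  have "area2 (vtx h i j) (vtx h (i+1) (j+1)) (vtx h (i+1) j) = 2 * h * h"
    by (simp add: area2_def vtx_def algebra_simps)
  then have nz: "area2 (vtx h i j) (vtx h (i+1) (j+1)) (vtx h (i+1) j) \<noteq> 0"
    using assms by simp
  have "(1 - u) *\<^sub>R vtx h i j + w *\<^sub>R vtx h (i+1) (j+1) + (u - w) *\<^sub>R vtx h (i+1) j
        = lat h (of_int i + u) (of_int j + w)"
    by (simp add: vtx_def lat_def algebra_simps)
  with barycentric_coordinates[OF nz, of "1 - u" w "u - w"
      "lat h (of_int i + u) (of_int j + w)"]
  show "bary1 (vtx h i j) (vtx h (i+1) (j+1)) (vtx h (i+1) j) (lat h (of_int i + u) (of_int j + w)) = 1 - u"
    and "bary2 (vtx h i j) (vtx h (i+1) (j+1)) (vtx h (i+1) j) (lat h (of_int i + u) (of_int j + w)) = w"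
    and "bary3 (vtx h i j) (vtx h (i+1) (j+1)) (vtx h (i+1) j) (lat h (of_int i + u) (of_int j + w)) = u - w"
    by auto
qed

lemma bary_tri':
  assumes "h > 0"
  shows "bary1 (vtx h i (j+1)) (vtx h (i+1) (j+1)) (vtx h i j) (lat h (of_int i + u) (of_int j + w)) = w - u"
    and "bary2 (vtx h i (j+1)) (vtx h (i+1) (j+1)) (vtx h i j) (lat h (of_int i + u) (of_int j + w)) = u"
    and "bary3 (vtx h i (j+1)) (vtx h (i+1) (j+1)) (vtx h i j) (lat h (of_int i + u) (of_int j + w)) = 1 - w"
proof -
  have "area2 (vtx h i (j+1)) (vtx h (i+1) (j+1)) (vtx h i j) = 2 * h * h"
    by (simp add: area2_def vtx_def algebra_simps)
  then have nz: "area2 (vtx h i (j+1)) (vtx h (i+1) (j+1)) (vtx h i j) \<noteq> 0"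
    using assms by simp
  have "(w - u) *\<^sub>R vtx h i (j+1) + u *\<^sub>R vtx h (i+1) (j+1) + (1 - w) *\<^sub>R vtx h i j
        = lat h (of_int i + u) (of_int j + w)"
    by (simp add: vtx_def lat_def algebra_simps)
  with barycentric_coordinates[OF nz, of "w - u" u "1 - w"
      "lat h (of_int i + u) (of_int j + w)"]
  show "bary1 (vtx h i (j+1)) (vtx h (i+1) (j+1)) (vtx h i j) (lat h (of_int i + u) (of_int j + w)) = w - u"
    and "bary2 (vtx h i (j+1)) (vtx h (i+1) (j+1)) (vtx h i j) (lat h (of_int i + u) (of_int j + w)) = u"
    and "bary3 (vtx h i (j+1)) (vtx h (i+1) (j+1)) (vtx h i j) (lat h (of_int i + u) (of_int j + w)) = 1 - w"
    by auto
qed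

lemma lat_inverse:
  assumes "h > 0"
  shows "lat h s t = p \<longleftrightarrow> s = (fst p + snd p) / (2 * h) \<and> t = (fst p - snd p) / (2 * h)"
  using assms by (cases p) (auto simp: lat_def field_simps)

lemma mem_tri_iff:
  assumes "h > 0"
  shows "p \<in> tri h i j \<longleftrightarrow>
    (\<exists>u w. 0 \<le> w \<and> w \<le> u \<and> u \<le> 1 \<and> p = lat h (of_int i + u) (of_int j + w))"
proof
  assume "p \<in> tri h i j"
  then obtain a b c where abc: "0 \<le> a" "0 \<le> b" "0 \<le> c" "a + b + c = 1"
    "p = a *\<^sub>R vtx h i j + b *\<^sub>R vtx h (i+1) (j+1) + c *\<^sub>R vtx h (i+1) j"
    by (auto simp: tri_def convex_hull_3)
  then have "a = 1 - b - c" by simp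
  with abc have "p = lat h (of_int i + (b + c)) (of_int j + b)"
    by (simp add: vtx_def lat_def algebra_simps)
  with abc show "\<exists>u w. 0 \<le> w \<and> w \<le> u \<and> u \<le> 1 \<and> p = lat h (of_int i + u) (of_int j + w)"
    by (intro exI[of _ "b + c"] exI[of _ b]) auto
next
  assume "\<exists>u w. 0 \<le> w \<and> w \<le> u \<and> u \<le> 1 \<and> p = lat h (of_int i + u) (of_int j + w)"
  then obtain u w where uw: "0 \<le> w" "w \<le> u" "u \<le> 1" "p = lat h (of_int i + u) (of_int j + w)"
    by blast
  then have "p = (1 - u) *\<^sub>R vtx h i j + w *\<^sub>R vtx h (i+1) (j+1) + (u - w) *\<^sub>R vtx h (i+1) j"
    by (simp add: vtx_def lat_def algebra_simps)
  with uw show "p \<in> tri h i j"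
    unfolding tri_def convex_hull_3 mem_Collect_eq
    by (intro exI[of _ "1 - u"] exI[of _ w] exI[of _ "u - w"]) auto
qed

lemma mem_tri'_iff:
  assumes "h > 0"
  shows "p \<in> tri' h i j \<longleftrightarrow>
    (\<exists>u w. 0 \<le> u \<and> u \<le> w \<and> w \<le> 1 \<and> p = lat h (of_int i + u) (of_int j + w))"
proof
  assume "p \<in> tri' h i j"
  then obtain a b c where abc: "0 \<le> a" "0 \<le> b" "0 \<le> c" "a + b + c = 1"
    "p = a *\<^sub>R vtx h i j + b *\<^sub>R vtx h (i+1) (j+1) + c *\<^sub>R vtx h i (j+1)"
    by (auto simp: tri'_def convex_hull_3)
  then have "a = 1 - b - c" by simp
  with abc have "p = lat h (of_int i + b) (of_int j + (b + c))"
    by (simp add: vtx_def lat_def algebra_simps)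
  with abc show "\<exists>u w. 0 \<le> u \<and> u \<le> w \<and> w \<le> 1 \<and> p = lat h (of_int i + u) (of_int j + w)"
    by (intro exI[of _ b] exI[of _ "b + c"]) auto
next
  assume "\<exists>u w. 0 \<le> u \<and> u \<le> w \<and> w \<le> 1 \<and> p = lat h (of_int i + u) (of_int j + w)"
  then obtain u w where uw: "0 \<le> u" "u \<le> w" "w \<le> 1" "p = lat h (of_int i + u) (of_int j + w)"
    by blast
  then have "p = (1 - w) *\<^sub>R vtx h i j + u *\<^sub>R vtx h (i+1) (j+1) + (w - u) *\<^sub>R vtx h i (j+1)"
    by (simp add: vtx_def lat_def algebra_simps)
  with uw show "p \<in> tri' h i j"
    unfolding tri'_def convex_hull_3 mem_Collect_eq
    by (intro exI[of _ "1 - w"] exI[of _ u] exI[of _ "w - u"]) auto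
qed

lemma bb_tri_lat:
  assumes "h > 0"
  shows "bb_tri h M f i j (lat h (of_int i + u) (of_int j + w)) =
    (let V = bb_coeff h M f Vert;
         U = (\<lambda>d. bb_coeff h M f (Edge d));
         C = bb_coeff h M f Cen
     in V i j * (1-u)^3 + 3 * U PP i j * (1-u)^2 * w + 3 * U PZ i j * (1-u)^2 * (u-w)
      + 3 * U NN (i+1) (j+1) * (1-u) * w^2 + 6 * C i j * (1-u) * w * (u-w)
      + 3 * U NZ (i+1) j * (1-u) * (u-w)^2
      + V (i+1) (j+1) * w^3 + 3 * U ZN (i+1) (j+1) * w^2 * (u-w)
      + 3 * U ZP (i+1) j * w * (u-w)^2 + V (i+1) j * (u-w)^3)"
  unfolding bb_tri_def bernstein3_def Let_def bary_tri[OF assms]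
  by (simp add: fact_numeral algebra_simps)

lemma bb_tri'_lat:
  assumes "h > 0"
  shows "bb_tri' h M f i j (lat h (of_int i + u) (of_int j + w)) =
    (let V = bb_coeff h M f Vert;
         U = (\<lambda>d. bb_coeff h M f (Edge d));
         C' = bb_coeff h M f Cen'
     in V i (j+1) * (w-u)^3 + 3 * U PZ i (j+1) * (w-u)^2 * u + 3 * U ZN i (j+1) * (w-u)^2 * (1-w)
      + 3 * U NZ (i+1) (j+1) * (w-u) * u^2 + 6 * C' i j * (w-u) * u * (1-w)
      + 3 * U ZP i j * (w-u) * (1-w)^2
      + V (i+1) (j+1) * u^3 + 3 * U NN (i+1) (j+1) * u^2 * (1-w)
      + 3 * U PP i j * u * (1-w)^2 + V i j * (1-w)^3)"
  unfolding bb_tri'_def bernstein3_def Let_def bary_tri'[OF assms]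
  by (simp add: fact_numeral algebra_simps)

lemma ex1_quasi_interpolant:
  assumes h: "h > 0"
  shows "\<exists>!q. is_quasi_interpolant h M f q"
proof -
  define F where "F s t = (let i = \<lfloor>s\<rfloor>; j = \<lfloor>t\<rfloor> in
      if frac t \<le> frac s then bb_tri h M f i j (lat h s t) else bb_tri' h M f i j (lat h s t))"
    for s t :: real
  define q where "q p = F ((fst p + snd p) / (2 * h)) ((fst p - snd p) / (2 * h))" for p
  have q_lat: "q (lat h s t) = F s t" for s t
    using lat_inverse[OF h, of s t "lat h s t"] unfolding q_def by simp
  have F_tri: "F (of_int i + u) (of_int j + w) = bb_tri h M f i j (lat h (of_int i + u) (of_int j + w))"
    if "0 \<le> w" "w \<le> u" "u < 1" for i j u w
  proof -
    have fl: "\<lfloor>of_int i + u\<rfloor> = i" "\<lfloor>of_int j + w\<rfloor> = j"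
      using that by linarith+
    show ?thesis using that by (simp add: F_def fl frac_def)
  qed
  have F_tri': "F (of_int i + u) (of_int j + w) = bb_tri' h M f i j (lat h (of_int i + u) (of_int j + w))"
    if "0 \<le> u" "u < w" "w < 1" for i j u w
  proof -
    have fl: "\<lfloor>of_int i + u\<rfloor> = i" "\<lfloor>of_int j + w\<rfloor> = j"
      using that by linarith+
    show ?thesis using that by (simp add: F_def fl frac_def)
  qed
  have T: "F (of_int i + u) (of_int j + w) = bb_tri h M f i j (lat h (of_int i + u) (of_int j + w))"
    if uw: "0 \<le> w" "w \<le> u" "u \<le> 1" for i j u w
  proof -
    consider "u < 1" | "u = 1" "w = 0" | "u = 1" "0 < w" "w < 1" | "u = 1" "w = 1"
      using uw by linarith
    then show ?thesis
    proof cases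
      case 1 then show ?thesis using F_tri uw by blast
    next
      case 2
      have "F (of_int (i+1) + 0) (of_int j + 0) = bb_tri h M f (i+1) j (lat h (of_int (i+1) + 0) (of_int j + 0))"
        by (rule F_tri) auto
      then show ?thesis using 2 unfolding bb_tri_lat[OF h] by (simp add: Let_def)
    next
      case 3
      have "F (of_int (i+1) + 0) (of_int j + w) = bb_tri' h M f (i+1) j (lat h (of_int (i+1) + 0) (of_int j + w))"
        by (rule F_tri') (use 3 in auto)
      then show ?thesis using 3 unfolding bb_tri_lat[OF h] bb_tri'_lat[OF h] by (simp add: Let_def)
    next
      case 4
      have "F (of_int (i+1) + 0) (of_int (j+1) + 0) = bb_tri h M f (i+1) (j+1) (lat h (of_int (i+1) + 0) (of_int (j+1) + 0))"
        by (rule F_tri) auto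
      then show ?thesis using 4 unfolding bb_tri_lat[OF h] by (simp add: Let_def)
    qed
  qed
  have T': "F (of_int i + u) (of_int j + w) = bb_tri' h M f i j (lat h (of_int i + u) (of_int j + w))"
    if uw: "0 \<le> u" "u \<le> w" "w \<le> 1" for i j u w
  proof -
    consider "u = w" | "u < w" "w < 1" | "u < w" "w = 1"
      using uw by linarith
    then show ?thesis
    proof cases
      case 1
      then have "F (of_int i + u) (of_int j + w) = bb_tri h M f i j (lat h (of_int i + u) (of_int j + w))"
        using T uw by simp
      then show ?thesis using 1 unfolding bb_tri_lat[OF h] bb_tri'_lat[OF h] by (simp add: Let_def)
    next
      case 2 then show ?thesis using F_tri' uw by blast
    next
      case 3
      have "F (of_int i + u) (of_int (j+1) + 0) = bb_tri h M f i (j+1) (lat h (of_int i + u) (of_int (j+1) + 0))"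
        by (rule F_tri) (use 3 uw in auto)
      then show ?thesis using 3 unfolding bb_tri_lat[OF h] bb_tri'_lat[OF h] by (simp add: Let_def)
    qed
  qed
  have "is_quasi_interpolant h M f q"
    unfolding is_quasi_interpolant_def Ball_def mem_tri_iff[OF h] mem_tri'_iff[OF h]
    using T T' q_lat by force
  moreover have "q1 = q2"
    if "is_quasi_interpolant h M f q1" "is_quasi_interpolant h M f q2" for q1 q2
  proof
    fix p
    define s t where "s = (fst p + snd p) / (2 * h)" and "t = (fst p - snd p) / (2 * h)"
    have p: "p = lat h (of_int \<lfloor>s\<rfloor> + frac s) (of_int \<lfloor>t\<rfloor> + frac t)"
      using lat_inverse[OF h, of s t p] by (simp add: s_def t_def frac_def)
    have "p \<in> tri h \<lfloor>s\<rfloor> \<lfloor>t\<rfloor> \<or> p \<in> tri' h \<lfloor>s\<rfloor> \<lfloor>t\<rfloor>"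
      unfolding mem_tri_iff[OF h] mem_tri'_iff[OF h] using p
      by (metis frac_ge_0 frac_lt_1 less_imp_le linear)
    then show "q1 p = q2 p"
      using that unfolding is_quasi_interpolant_def by metis
  qed
  ultimately show ?thesis by blast
qed

lemma is_quasi_interpolant_quasi_interp:
  "h > 0 \<Longrightarrow> is_quasi_interpolant h M f (quasi_interp h M f)"
  unfolding quasi_interp_def by (rule theI'[OF ex1_quasi_interpolant])

definition maps_to_splines :: "real \<Rightarrow> masks \<Rightarrow> bool" where
  "maps_to_splines h M \<longleftrightarrow> (\<forall>f. C1_plane f \<longrightarrow> quasi_interp h M f \<in> spline31 h)"

definition exact_on_quadratics :: "real \<Rightarrow> masks \<Rightarrow> bool" where
  "exact_on_quadratics h M \<longleftrightarrow> (\<forall>p. poly2_deg_le 2 p \<longrightarrow> quasi_interp h M p = p)"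

end

theory Submission
  imports Defs
begin

text \<open>A mask enters the construction through three columns, one for each type of datum
(\<open>f\<close>, \<open>h\<close> times its \<open>x\<close>-derivative, \<open>h\<close> times its \<open>y\<close>-derivative), and the problem decouples into
a smoothness condition on each column and a moment condition that links them.

\<^emph>\<open>Smoothness.\<close> On every triangle the quasi-interpolant is a cubic in Bernstein form, so being \<open>C\<^sup>1\<close>
is a set of linear relations between Bernstein ordinates of neighbouring triangles
(\<open>C1_net\<close>, \<open>quasi_interp_spline_iff\<close>). There are \<open>C\<^sup>1\<close> functions that carry a single nonzero
datum at the origin and none at any other vertex (\<open>bump_jet\<close>). For such a function the net of ordinates
is a column of the mask, spread out over the lattice, so every column must itself be a
\<open>C\<^sup>1\<close> net of small support. Solving these relations leaves four free weights
per column (\<open>C1_mask_net_imp_spline_masks\<close>): the net is a combination of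
the cubic splines attached to four of the six triangles at the origin. Conversely, translates of these
nets combine to a \<open>C\<^sup>1\<close> net for arbitrary data (\<open>C1_net_spline_masks\<close>). Hence condition (i) says that the
masks lie in a space of dimension \<open>3 * 4 = 12\<close> (\<open>maps_to_splines_iff\<close>).

\<^emph>\<open>Exactness.\<close> A quadratic polynomial and its translates have the same form, so an ordinate
functional reproduces the Bernstein ordinates of all quadratics at every vertex as soon as its six moments
have the right values (\<open>exact_on_quadratics_iff\<close>). On the space of dimension 12 the moment equations are
consistent and have rank 7, and solving them produces an explicit injective affine parametrization by five
real numbers (\<open>solution_of_moments\<close>, \<open>moments_solution\<close>, \<open>inj_solution\<close>).\<close>

section \<open>Bernstein form of the pieces\<close>

text \<open>The coefficients \<open>c\<^sub>i\<^sub>j\<^sub>k\<close> multiply the Bernstein polynomials with exponents \<open>(i, j, k)\<close>; their order is the one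
in which the local formulas of the quasi-interpolant list them.\<close>

definition cubic_form :: "real \<Rightarrow> real \<Rightarrow> real \<Rightarrow> real \<Rightarrow> real \<Rightarrow> real \<Rightarrow> real \<Rightarrow> real \<Rightarrow> real \<Rightarrow> real \<Rightarrow> real \<Rightarrow> real \<Rightarrow> real \<Rightarrow> real" where
  "cubic_form c300 c210 c201 c120 c111 c102 c030 c021 c012 c003 x y z =
     c300 * x^3 + 3 * c210 * x^2 * y + 3 * c201 * x^2 * z + 3 * c120 * x * y^2 + 6 * c111 * x * y * z
     + 3 * c102 * x * z^2 + c030 * y^3 + 3 * c021 * y^2 * z + 3 * c012 * y * z^2 + c003 * z^3"

definition quadratic_form :: "real \<Rightarrow> real \<Rightarrow> real \<Rightarrow> real \<Rightarrow> real \<Rightarrow> real \<Rightarrow> real \<Rightarrow> real \<Rightarrow> real \<Rightarrow> real" where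
  "quadratic_form c200 c110 c101 c020 c011 c002 x y z =
     c200 * x^2 + 2 * c110 * x * y + 2 * c101 * x * z + c020 * y^2 + 2 * c011 * y * z + c002 * z^2"

text \<open>All Bernstein ordinates of a piecewise cubic: \<open>B c i j\<close> is the ordinate of kind \<open>c\<close> attached
to the vertex \<open>v\<^sub>i\<^sub>,\<^sub>j\<close>. An edge ordinate belongs to both triangles at that edge, which makes the
piecewise cubic continuous.\<close>

type_synonym net = "coefficient \<Rightarrow> int \<Rightarrow> int \<Rightarrow> real"

text \<open>The arguments \<open>(u, w)\<close> are lattice coordinates relative to \<open>v\<^sub>i\<^sub>,\<^sub>j\<close>. The barycentric coordinates are affine
in them: \<open>(1 - u, w, u - w)\<close> on \<open>tri\<close> and \<open>(w - u, u, 1 - w)\<close> on \<open>tri'\<close>.\<close>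

definition patch :: "net \<Rightarrow> int \<Rightarrow> int \<Rightarrow> real \<Rightarrow> real \<Rightarrow> real" where
  "patch B i j u w =
    cubic_form (B Vert i j) (B (Edge PP) i j) (B (Edge PZ) i j) (B (Edge NN) (i+1) (j+1)) (B Cen i j)
      (B (Edge NZ) (i+1) j) (B Vert (i+1) (j+1)) (B (Edge ZN) (i+1) (j+1)) (B (Edge ZP) (i+1) j)
      (B Vert (i+1) j) (1 - u) w (u - w)"

definition patch' :: "net \<Rightarrow> int \<Rightarrow> int \<Rightarrow> real \<Rightarrow> real \<Rightarrow> real" where
  "patch' B i j u w =
    cubic_form (B Vert i (j+1)) (B (Edge PZ) i (j+1)) (B (Edge ZN) i (j+1)) (B (Edge NZ) (i+1) (j+1)) (B Cen' i j)
      (B (Edge ZP) i j) (B Vert (i+1) (j+1)) (B (Edge NN) (i+1) (j+1)) (B (Edge PP) i j)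
      (B Vert i j) (w - u) u (1 - w)"

lemma bb_tri_patch: "h > 0 \<Longrightarrow> bb_tri h M f i j (lat h (of_int i + u) (of_int j + w)) = patch (bb_coeff h M f) i j u w"
  by (simp add: bb_tri_lat patch_def cubic_form_def Let_def)

lemma bb_tri'_patch: "h > 0 \<Longrightarrow> bb_tri' h M f i j (lat h (of_int i + u) (of_int j + w)) = patch' (bb_coeff h M f) i j u w"
  by (simp add: bb_tri'_lat patch'_def cubic_form_def Let_def)

text \<open>The derivatives along the two lattice directions, again in Bernstein form: differentiating along an edge
replaces the ordinates by three times their differences along that edge.\<close>

definition patch_s :: "net \<Rightarrow> int \<Rightarrow> int \<Rightarrow> real \<Rightarrow> real \<Rightarrow> real" where
  "patch_s B i j u w = 3 *
    quadratic_form (B (Edge PZ) i j - B Vert i j) (B Cen i j - B (Edge PP) i j)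
      (B (Edge NZ) (i+1) j - B (Edge PZ) i j) (B (Edge ZN) (i+1) (j+1) - B (Edge NN) (i+1) (j+1))
      (B (Edge ZP) (i+1) j - B Cen i j) (B Vert (i+1) j - B (Edge NZ) (i+1) j) (1 - u) w (u - w)"

definition patch_t :: "net \<Rightarrow> int \<Rightarrow> int \<Rightarrow> real \<Rightarrow> real \<Rightarrow> real" where
  "patch_t B i j u w = 3 *
    quadratic_form (B (Edge PP) i j - B (Edge PZ) i j) (B (Edge NN) (i+1) (j+1) - B Cen i j)
      (B Cen i j - B (Edge NZ) (i+1) j) (B Vert (i+1) (j+1) - B (Edge ZN) (i+1) (j+1))
      (B (Edge ZN) (i+1) (j+1) - B (Edge ZP) (i+1) j) (B (Edge ZP) (i+1) j - B Vert (i+1) j) (1 - u) w (u - w)"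

definition patch'_s :: "net \<Rightarrow> int \<Rightarrow> int \<Rightarrow> real \<Rightarrow> real \<Rightarrow> real" where
  "patch'_s B i j u w = 3 *
    quadratic_form (B (Edge PZ) i (j+1) - B Vert i (j+1)) (B (Edge NZ) (i+1) (j+1) - B (Edge PZ) i (j+1))
      (B Cen' i j - B (Edge ZN) i (j+1)) (B Vert (i+1) (j+1) - B (Edge NZ) (i+1) (j+1))
      (B (Edge NN) (i+1) (j+1) - B Cen' i j) (B (Edge PP) i j - B (Edge ZP) i j) (w - u) u (1 - w)"

definition patch'_t :: "net \<Rightarrow> int \<Rightarrow> int \<Rightarrow> real \<Rightarrow> real \<Rightarrow> real" where
  "patch'_t B i j u w = 3 *
    quadratic_form (B Vert i (j+1) - B (Edge ZN) i (j+1)) (B (Edge PZ) i (j+1) - B Cen' i j)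
      (B (Edge ZN) i (j+1) - B (Edge ZP) i j) (B (Edge NZ) (i+1) (j+1) - B (Edge NN) (i+1) (j+1))
      (B Cen' i j - B (Edge PP) i j) (B (Edge ZP) i j - B Vert i j) (w - u) u (1 - w)"

lemma cubic_form_has_derivative:
  assumes "(x has_derivative x') (at p within S)" "(y has_derivative y') (at p within S)" "(z has_derivative z') (at p within S)"
  shows "((\<lambda>p. cubic_form a b c d e f g k l m (x p) (y p) (z p)) has_derivative
    (\<lambda>v. 3 * (quadratic_form a b c d e f (x p) (y p) (z p) * x' v + quadratic_form b d e g k l (x p) (y p) (z p) * y' v
       + quadratic_form c e f k l m (x p) (y p) (z p) * z' v))) (at p within S)"
  unfolding cubic_form_def
  by (rule derivative_eq_intros assms refl)+
     (simp add: fun_eq_iff quadratic_form_def algebra_simps power2_eq_square)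

lemma patch_has_derivative:
  assumes "(a has_derivative a') (at p within S)" "(b has_derivative b') (at p within S)"
  shows "((\<lambda>p. patch B i j (a p) (b p)) has_derivative
      (\<lambda>v. patch_s B i j (a p) (b p) * a' v + patch_t B i j (a p) (b p) * b' v)) (at p within S)"
    and "((\<lambda>p. patch' B i j (a p) (b p)) has_derivative
      (\<lambda>v. patch'_s B i j (a p) (b p) * a' v + patch'_t B i j (a p) (b p) * b' v)) (at p within S)"
  unfolding patch_def patch'_def
  by (rule has_derivative_eq_rhs, rule cubic_form_has_derivative, (rule derivative_eq_intros assms refl)+,
      simp add: fun_eq_iff patch_s_def patch_t_def patch'_s_def patch'_t_def quadratic_form_def algebra_simps)+

section \<open>Smoothness across the edges as relations between ordinates\<close>

text \<open>Two cubics over adjacent triangles join smoothly when, for each of the three pairs of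
small triangles of the control net that share a piece of the common edge, the four corners form
an affine parallelogram. The first six relations are those at the ends of the edges:
the ordinates around a vertex form an affine hexagon. The last three, one for each edge direction, concern
the middle of an edge and involve the central ordinates of both triangles.\<close>

definition C1_net :: "net \<Rightarrow> bool" where
  "C1_net B \<longleftrightarrow> (\<forall>i j.
     B (Edge PP) i j + B (Edge ZN) i j = B Vert i j + B (Edge PZ) i j \<and>
     B (Edge PZ) i j + B (Edge ZP) i j = B Vert i j + B (Edge PP) i j \<and>
     B (Edge PP) i j + B (Edge NZ) i j = B Vert i j + B (Edge ZP) i j \<and>
     B (Edge ZP) i j + B (Edge NN) i j = B Vert i j + B (Edge NZ) i j \<and>
     B (Edge NZ) i j + B (Edge ZN) i j = B Vert i j + B (Edge NN) i j \<and>
     B (Edge NN) i j + B (Edge PZ) i j = B Vert i j + B (Edge ZN) i j \<and>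
     B Cen i j + B Cen' i j = B (Edge PP) i j + B (Edge NN) (i+1) (j+1) \<and>
     B Cen i (j+1) + B Cen' i j = B (Edge PZ) i (j+1) + B (Edge NZ) (i+1) (j+1) \<and>
     B Cen i j + B Cen' (i+1) j = B (Edge ZP) (i+1) j + B (Edge ZN) (i+1) (j+1))"

text \<open>The affine hexagon around a vertex is determined by its centre and two corners.\<close>

lemma C1_netD:
  assumes "C1_net B"
  shows "B (Edge PP) i j = B (Edge PZ) i j + B (Edge ZP) i j - B Vert i j"
    "B (Edge NZ) i j = 2 * B Vert i j - B (Edge PZ) i j"
    "B (Edge ZN) i j = 2 * B Vert i j - B (Edge ZP) i j"
    "B (Edge NN) i j = 3 * B Vert i j - B (Edge PZ) i j - B (Edge ZP) i j"
  using assms[unfolded C1_net_def, rule_format, of i j] by linarith+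

lemma gradients_match_if_C1_net:
  assumes N: "C1_net B"
  shows "patch_s B i j u u = patch'_s B i j u u" "patch_t B i j u u = patch'_t B i j u u"
    "patch_s B i (j+1) u 0 = patch'_s B i j u 1" "patch_t B i (j+1) u 0 = patch'_t B i j u 1"
    "patch_s B i j 1 w = patch'_s B (i+1) j 0 w" "patch_t B i j 1 w = patch'_t B (i+1) j 0 w"
proof -
  note R = C1_netD[OF N]
  note N' = N[unfolded C1_net_def, rule_format]
  have c: "B Cen' i j = B (Edge PP) i j + B (Edge NN) (i+1) (j+1) - B Cen i j"
    using N'[of i j] by linarith
  show "patch_s B i j u u = patch'_s B i j u u" "patch_t B i j u u = patch'_t B i j u u"
    by (simp_all add: patch_s_def patch_t_def patch'_s_def patch'_t_def quadratic_form_def c)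
       (simp_all add: R algebra_simps)
  have c: "B Cen i (j+1) = B (Edge PZ) i (j+1) + B (Edge NZ) (i+1) (j+1) - B Cen' i j"
    using N'[of i j] by linarith
  show "patch_s B i (j+1) u 0 = patch'_s B i j u 1" "patch_t B i (j+1) u 0 = patch'_t B i j u 1"
    by (simp_all add: patch_s_def patch_t_def patch'_s_def patch'_t_def quadratic_form_def c)
       (simp_all add: R algebra_simps)
  have c: "B Cen' (i+1) j = B (Edge ZP) (i+1) j + B (Edge ZN) (i+1) (j+1) - B Cen i j"
    using N'[of i j] by linarith
  show "patch_s B i j 1 w = patch'_s B (i+1) j 0 w" "patch_t B i j 1 w = patch'_t B (i+1) j 0 w"
    by (simp_all add: patch_s_def patch_t_def patch'_s_def patch'_t_def quadratic_form_def c)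
       (simp_all add: R algebra_simps)
qed

text \<open>Along an edge the two transversal derivatives are quadratic polynomials in one variable. Their equality at three
points forces equality of all three Bernstein ordinates. Interior points suffice, and only there does the
transversal line run through both triangles.\<close>

lemma C1_net_if_gradients_match:
  assumes D: "\<And>i j u. 0 < u \<Longrightarrow> u < 1 \<Longrightarrow> patch_s B i j u u = patch'_s B i j u u"
    and H: "\<And>i j u. 0 < u \<Longrightarrow> u < 1 \<Longrightarrow> patch_t B i (j+1) u 0 = patch'_t B i j u 1"
    and V: "\<And>i j w. 0 < w \<Longrightarrow> w < 1 \<Longrightarrow> patch_s B i j 1 w = patch'_s B (i+1) j 0 w"
  shows "C1_net B"
proof -
  note S = patch_s_def patch_t_def patch'_s_def patch'_t_def quadratic_form_def power2_eq_square
  have d: "B (Edge PZ) i j + B (Edge ZP) i j = B Vert i j + B (Edge PP) i j"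
     "B (Edge NZ) (i+1) (j+1) + B (Edge ZN) (i+1) (j+1) = B Vert (i+1) (j+1) + B (Edge NN) (i+1) (j+1)"
     "B Cen i j + B Cen' i j = B (Edge PP) i j + B (Edge NN) (i+1) (j+1)" for i j
    using D[of "1/4" i j] D[of "1/2" i j] D[of "3/4" i j] by (simp_all add: S add_divide_distrib diff_divide_distrib)
  have e: "B (Edge PP) i (j+1) + B (Edge ZN) i (j+1) = B Vert i (j+1) + B (Edge PZ) i (j+1)"
     "B (Edge ZP) (i+1) (j+1) + B (Edge NN) (i+1) (j+1) = B Vert (i+1) (j+1) + B (Edge NZ) (i+1) (j+1)"
     "B Cen i (j+1) + B Cen' i j = B (Edge PZ) i (j+1) + B (Edge NZ) (i+1) (j+1)" for i j
    using H[of "1/4" i j] H[of "1/2" i j] H[of "3/4" i j] by (simp_all add: S add_divide_distrib diff_divide_distrib)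
  have f: "B (Edge PP) (i+1) j + B (Edge NZ) (i+1) j = B Vert (i+1) j + B (Edge ZP) (i+1) j"
     "B (Edge NN) (i+1) (j+1) + B (Edge PZ) (i+1) (j+1) = B Vert (i+1) (j+1) + B (Edge ZN) (i+1) (j+1)"
     "B Cen i j + B Cen' (i+1) j = B (Edge ZP) (i+1) j + B (Edge ZN) (i+1) (j+1)" for i j
    using V[of "1/4" i j] V[of "1/2" i j] V[of "3/4" i j] by (simp_all add: S add_divide_distrib diff_divide_distrib)
  show ?thesis unfolding C1_net_def
    using d(1,3) d(2)[of "i-1" "j-1" for i j] e(3) e(1)[of i "j-1" for i j] e(2)[of "i-1" "j-1" for i j]
      f(3) f(1)[of "i-1" for i] f(2)[of "i-1" "j-1" for i j] by simp
qed

section \<open>Piecewise functions on the triangulation\<close>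


definition lat_s :: "real \<Rightarrow> real \<times> real \<Rightarrow> real" where "lat_s h p = (fst p + snd p) / (2 * h)"
definition lat_t :: "real \<Rightarrow> real \<times> real \<Rightarrow> real" where "lat_t h p = (fst p - snd p) / (2 * h)"

lemma lat_coords:
  assumes "h > 0"
  shows "lat h (lat_s h p) (lat_t h p) = p" "lat_s h (lat h s t) = s" "lat_t h (lat h s t) = t"
  using lat_inverse[OF assms, of "lat_s h p" "lat_t h p" p] lat_inverse[OF assms, of s t "lat h s t"]
  by (simp_all add: lat_s_def lat_t_def)

lemma mem_tri_coords:
  assumes "h > 0"
  shows "p \<in> tri h i j \<longleftrightarrow> 0 \<le> lat_t h p - of_int j \<and> lat_t h p - of_int j \<le> lat_s h p - of_int i \<and> lat_s h p - of_int i \<le> 1"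
  unfolding mem_tri_iff[OF assms]
proof safe
  assume "0 \<le> lat_t h p - of_int j" "lat_t h p - of_int j \<le> lat_s h p - of_int i" "lat_s h p - of_int i \<le> 1"
  then show "\<exists>u w. 0 \<le> w \<and> w \<le> u \<and> u \<le> 1 \<and> p = lat h (of_int i + u) (of_int j + w)"
    by (intro exI[of _ "lat_s h p - of_int i"] exI[of _ "lat_t h p - of_int j"]) (simp add: lat_coords(1)[OF assms])
qed (simp_all add: lat_coords[OF assms])

lemma mem_tri'_coords:
  assumes "h > 0"
  shows "p \<in> tri' h i j \<longleftrightarrow> 0 \<le> lat_s h p - of_int i \<and> lat_s h p - of_int i \<le> lat_t h p - of_int j \<and> lat_t h p - of_int j \<le> 1"
  unfolding mem_tri'_iff[OF assms]
proof safe
  assume "0 \<le> lat_s h p - of_int i" "lat_s h p - of_int i \<le> lat_t h p - of_int j" "lat_t h p - of_int j \<le> 1"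
  then show "\<exists>u w. 0 \<le> u \<and> u \<le> w \<and> w \<le> 1 \<and> p = lat h (of_int i + u) (of_int j + w)"
    by (intro exI[of _ "lat_s h p - of_int i"] exI[of _ "lat_t h p - of_int j"]) (simp add: lat_coords(1)[OF assms])
qed (simp_all add: lat_coords[OF assms])

lemma lat_coords_has_derivative [derivative_intros]:
  "(lat_s h has_derivative lat_s h) F" "(lat_t h has_derivative lat_t h) F"
proof -
  have "bounded_linear (lat_s h)" "bounded_linear (lat_t h)"
    unfolding lat_s_def lat_t_def divide_inverse
    by (intro bounded_linear_mult_const bounded_linear_add bounded_linear_sub bounded_linear_fst bounded_linear_snd)+
  then show "(lat_s h has_derivative lat_s h) F" "(lat_t h has_derivative lat_t h) F"
    by (simp_all add: bounded_linear_imp_has_derivative)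
qed

lemma continuous_on_lat_coords [continuous_intros]: "continuous_on A (lat_s h)" "continuous_on A (lat_t h)"
  unfolding lat_s_def lat_t_def divide_inverse by (intro continuous_intros)+

lemma triangles_cover:
  assumes "h > 0"
  shows "p \<in> tri h \<lfloor>lat_s h p\<rfloor> \<lfloor>lat_t h p\<rfloor> \<union> tri' h \<lfloor>lat_s h p\<rfloor> \<lfloor>lat_t h p\<rfloor>"
proof -
  have "0 \<le> lat_s h p - \<lfloor>lat_s h p\<rfloor>" "lat_s h p - \<lfloor>lat_s h p\<rfloor> \<le> 1"
    "0 \<le> lat_t h p - \<lfloor>lat_t h p\<rfloor>" "lat_t h p - \<lfloor>lat_t h p\<rfloor> \<le> 1" by linarith+
  then show ?thesis unfolding Un_iff mem_tri_coords[OF assms] mem_tri'_coords[OF assms] by linarith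
qed

lemma closed_tri: "closed (tri h i j)" "closed (tri' h i j)"
  unfolding tri_def tri'_def by (intro compact_imp_closed finite_imp_compact_convex_hull; simp)+

lemma filterlim_within_UN:
  assumes "finite K" "\<And>k. k \<in> K \<Longrightarrow> filterlim g F (at p within S k)"
  shows "filterlim g F (at p within (\<Union>k\<in>K. S k))"
  using assms
  by (induction K rule: finite_induct) (auto simp: filterlim_def at_within_union filtermap_sup)

text \<open>Only finitely many triangles come near a given point, and together they cover a neighbourhood
of it. A limit at the point can therefore be checked separately inside each closed triangle that contains it.
Continuity and differentiability of piecewise functions both reduce to this lemma.\<close>

lemma filterlim_at_triangles:
  assumes h: "h > 0"
    and T: "\<And>i j. p \<in> tri h i j \<Longrightarrow> filterlim g F (at p within tri h i j)"
    and T': "\<And>i j. p \<in> tri' h i j \<Longrightarrow> filterlim g F (at p within tri' h i j)"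
  shows "filterlim g F (at p)"
proof -
  \<comment> \<open>A closed set that misses the point imposes no condition.\<close>
  have vac: "filterlim g F (at p within S)" if "closed S" "p \<notin> S" for S
  proof -
    have "at p within S = bot"
      using that unfolding trivial_limit_within closed_limpt by blast
    then show ?thesis by (simp add: filterlim_def)
  qed
  define K where "K = {\<lfloor>lat_s h p\<rfloor> - 1 .. \<lfloor>lat_s h p\<rfloor> + 1} \<times> {\<lfloor>lat_t h p\<rfloor> - 1 .. \<lfloor>lat_t h p\<rfloor> + 1}"
  define S where "S k = tri h (fst k) (snd k) \<union> tri' h (fst k) (snd k)" for k :: "int \<times> int"
  have "filterlim g F (at p within tri h i j)" "filterlim g F (at p within tri' h i j)" for i j
    using T[of i j] T'[of i j] vac[OF closed_tri(1)[of h i j]] vac[OF closed_tri(2)[of h i j]] by blast+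
  then have "filterlim g F (at p within S k)" for k
    unfolding S_def at_within_union by (intro filterlim_sup)
  then have lim: "filterlim g F (at p within (\<Union>k\<in>K. S k))"
    by (intro filterlim_within_UN) (simp_all add: K_def)
  define W where "W = {q. \<bar>lat_s h q - lat_s h p\<bar> < 1} \<inter> {q. \<bar>lat_t h q - lat_t h p\<bar> < 1}"
  have "open W"
    unfolding W_def by (intro open_Int open_Collect_less continuous_intros)
  moreover have "p \<in> W" by (simp add: W_def)
  moreover have "W \<subseteq> (\<Union>k\<in>K. S k)"
  proof
    fix q assume "q \<in> W"
    then have "\<bar>lat_s h q - lat_s h p\<bar> < 1" "\<bar>lat_t h q - lat_t h p\<bar> < 1" by (auto simp: W_def)
    then have "(\<lfloor>lat_s h q\<rfloor>, \<lfloor>lat_t h q\<rfloor>) \<in> K"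
      unfolding K_def mem_Times_iff atLeastAtMost_iff fst_conv snd_conv by linarith
    then show "q \<in> (\<Union>k\<in>K. S k)"
      using triangles_cover[OF h, of q] unfolding S_def by force
  qed
  ultimately have "p \<in> interior (\<Union>k\<in>K. S k)"
    by (rule interiorI)
  then show ?thesis using lim at_within_interior by metis
qed

definition piecewise :: "real \<Rightarrow> (int \<Rightarrow> int \<Rightarrow> real \<Rightarrow> real \<Rightarrow> real) \<Rightarrow> (int \<Rightarrow> int \<Rightarrow> real \<Rightarrow> real \<Rightarrow> real)
    \<Rightarrow> (real \<times> real \<Rightarrow> real) \<Rightarrow> bool" where
  "piecewise h A A' q \<longleftrightarrow> (\<forall>i j p.
     (p \<in> tri h i j \<longrightarrow> q p = A i j (lat_s h p - of_int i) (lat_t h p - of_int j)) \<and>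
     (p \<in> tri' h i j \<longrightarrow> q p = A' i j (lat_s h p - of_int i) (lat_t h p - of_int j)))"

lemma piecewise_tri:
  assumes "piecewise h A A' q"
  shows "p \<in> tri h i j \<Longrightarrow> q p = A i j (lat_s h p - of_int i) (lat_t h p - of_int j)"
    and "p \<in> tri' h i j \<Longrightarrow> q p = A' i j (lat_s h p - of_int i) (lat_t h p - of_int j)"
  using assms unfolding piecewise_def by blast+

lemma piecewiseD:
  assumes "piecewise h A A' q" "h > 0"
  shows "0 \<le> w \<Longrightarrow> w \<le> u \<Longrightarrow> u \<le> 1 \<Longrightarrow> q (lat h (of_int i + u) (of_int j + w)) = A i j u w"
    and "0 \<le> u \<Longrightarrow> u \<le> w \<Longrightarrow> w \<le> 1 \<Longrightarrow> q (lat h (of_int i + u) (of_int j + w)) = A' i j u w"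
proof -
  let ?p = "lat h (of_int i + u) (of_int j + w)"
  have "(?p \<in> tri h i j \<longrightarrow> q ?p = A i j (lat_s h ?p - of_int i) (lat_t h ?p - of_int j)) \<and>
     (?p \<in> tri' h i j \<longrightarrow> q ?p = A' i j (lat_s h ?p - of_int i) (lat_t h ?p - of_int j))"
    using assms(1) unfolding piecewise_def by blast
  then show "0 \<le> w \<Longrightarrow> w \<le> u \<Longrightarrow> u \<le> 1 \<Longrightarrow> q ?p = A i j u w"
    and "0 \<le> u \<Longrightarrow> u \<le> w \<Longrightarrow> w \<le> 1 \<Longrightarrow> q ?p = A' i j u w"
    by (simp_all add: mem_tri_coords mem_tri'_coords lat_coords assms(2))
qed

lemma is_quasi_interpolant_iff_piecewise:
  assumes "h > 0"
  shows "is_quasi_interpolant h M f q \<longleftrightarrow> piecewise h (patch (bb_coeff h M f)) (patch' (bb_coeff h M f)) q"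
proof -
  have "bb_tri h M f i j p = patch (bb_coeff h M f) i j (lat_s h p - of_int i) (lat_t h p - of_int j)"
    "bb_tri' h M f i j p = patch' (bb_coeff h M f) i j (lat_s h p - of_int i) (lat_t h p - of_int j)" for i j p
    using bb_tri_patch[OF assms, of M f i j "lat_s h p - of_int i" "lat_t h p - of_int j"]
      bb_tri'_patch[OF assms, of M f i j "lat_s h p - of_int i" "lat_t h p - of_int j"]
    by (simp_all add: lat_coords(1)[OF assms])
  then show ?thesis unfolding is_quasi_interpolant_def piecewise_def by auto
qed

text \<open>Local functions that agree on the three kinds of edges glue to a function on the plane. The half-open
triangles inside one lattice cell give the definition; the closing edges and corners then follow
from the matching conditions.\<close>

lemma ex_piecewise:
  assumes h: "h > 0"
    and D: "\<And>i j u. A i j u u = A' i j u u"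
    and H: "\<And>i j u. A i (j+1) u 0 = A' i j u 1"
    and V: "\<And>i j w. A i j 1 w = A' (i+1) j 0 w"
  shows "\<exists>q. piecewise h A A' q"
proof -
  define q where "q p = (let i = \<lfloor>lat_s h p\<rfloor>; j = \<lfloor>lat_t h p\<rfloor>; u = frac (lat_s h p); w = frac (lat_t h p)
     in if w \<le> u then A i j u w else A' i j u w)" for p
  have q_lat: "q (lat h (of_int i + u) (of_int j + w)) = (if w \<le> u then A i j u w else A' i j u w)"
    if "0 \<le> u" "u < 1" "0 \<le> w" "w < 1" for i j u w
  proof -
    have "\<lfloor>of_int i + u\<rfloor> = i" "\<lfloor>of_int j + w\<rfloor> = j" using that by linarith+
    then show ?thesis by (simp add: q_def lat_coords[OF h] frac_def)
  qed
  have T: "q (lat h (of_int i + u) (of_int j + w)) = A i j u w"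
    if uw: "0 \<le> w" "w \<le> u" "u \<le> 1" for i j u w
  proof -
    consider "u < 1" | "u = 1" "w = 0" | "u = 1" "0 < w" "w < 1" | "u = 1" "w = 1"
      using uw by linarith
    then show ?thesis
    proof cases
      case 1 then show ?thesis using q_lat[of u w i j] uw by simp
    next
      case 2 then show ?thesis using q_lat[of 0 0 "i+1" j] D[of "i+1" j 0] V[of i j 0] by simp
    next
      case 3 then show ?thesis using q_lat[of 0 w "i+1" j] V[of i j w] by simp
    next
      case 4 then show ?thesis
        using q_lat[of 0 0 "i+1" "j+1"] H[of "i+1" j 0] V[of i j 1] by simp
    qed
  qed
  have T': "q (lat h (of_int i + u) (of_int j + w)) = A' i j u w"
    if uw: "0 \<le> u" "u \<le> w" "w \<le> 1" for i j u w
  proof -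
    consider "u = w" | "u < w" "w < 1" | "u < w" "w = 1"
      using uw by linarith
    then show ?thesis
    proof cases
      case 1 then show ?thesis using T[of w u i j] D[of i j u] uw by simp
    next
      case 2 then show ?thesis using q_lat[of u w i j] uw by simp
    next
      case 3 then show ?thesis using T[of 0 u i "j+1"] H[of i j u] uw by simp
    qed
  qed
  have "piecewise h A A' q"
    unfolding piecewise_def mem_tri_coords[OF h] mem_tri'_coords[OF h]
  proof (intro allI conjI impI)
    fix i j p
    have p: "lat h (of_int i + (lat_s h p - of_int i)) (of_int j + (lat_t h p - of_int j)) = p"
      by (simp add: lat_coords(1)[OF h])
    show "q p = A i j (lat_s h p - of_int i) (lat_t h p - of_int j)"
      if "0 \<le> lat_t h p - of_int j \<and> lat_t h p - of_int j \<le> lat_s h p - of_int i \<and> lat_s h p - of_int i \<le> 1"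
      using T[of "lat_t h p - of_int j" "lat_s h p - of_int i" i j, unfolded p] that by blast
    show "q p = A' i j (lat_s h p - of_int i) (lat_t h p - of_int j)"
      if "0 \<le> lat_s h p - of_int i \<and> lat_s h p - of_int i \<le> lat_t h p - of_int j \<and> lat_t h p - of_int j \<le> 1"
      using T'[of "lat_s h p - of_int i" "lat_t h p - of_int j" i j, unfolded p] that by blast
  qed
  then show ?thesis by blast
qed

lemma continuous_piecewise:
  assumes h: "h > 0" and q: "piecewise h A A' q"
    and cA: "\<And>i j. continuous_on UNIV (\<lambda>x. A i j (fst x) (snd x))"
    and cA': "\<And>i j. continuous_on UNIV (\<lambda>x. A' i j (fst x) (snd x))"
  shows "continuous_on UNIV q"
proof -
  have lim: "((\<lambda>p. G (lat_s h p - a) (lat_t h p - b)) \<longlongrightarrow> G (lat_s h p - a) (lat_t h p - b)) (at p within S)"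
    if "continuous_on UNIV (\<lambda>x. G (fst x) (snd x))" for G :: "real \<Rightarrow> real \<Rightarrow> real" and a b p S
  proof -
    have "continuous_on UNIV (\<lambda>p. (\<lambda>x. G (fst x) (snd x)) (lat_s h p - a, lat_t h p - b))"
      by (rule continuous_on_compose2[OF that]) (intro continuous_intros, simp)
    then have "((\<lambda>p. G (lat_s h p - a) (lat_t h p - b)) \<longlongrightarrow> G (lat_s h p - a) (lat_t h p - b)) (at p)"
      unfolding continuous_on_eq_continuous_at[OF open_UNIV] isCont_def fst_conv snd_conv by blast
    then show ?thesis by (rule Lim_at_imp_Lim_at_within)
  qed
  have "(q \<longlongrightarrow> q p) (at p)" for p
  proof (rule filterlim_at_triangles[OF h])
    fix i j
    let ?u = "\<lambda>p. lat_s h p - of_int i" and ?w = "\<lambda>p. lat_t h p - of_int j"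
    show "(q \<longlongrightarrow> q p) (at p within tri h i j)" if "p \<in> tri h i j"
      unfolding piecewise_tri(1)[OF q that]
      by (rule Lim_transform_within[OF lim[OF cA[of i j]] zero_less_one]) (rule piecewise_tri(1)[OF q, symmetric])
    show "(q \<longlongrightarrow> q p) (at p within tri' h i j)" if "p \<in> tri' h i j"
      unfolding piecewise_tri(2)[OF q that]
      by (rule Lim_transform_within[OF lim[OF cA'[of i j]] zero_less_one]) (rule piecewise_tri(2)[OF q, symmetric])
  qed
  then show ?thesis by (simp add: continuous_on_eq_continuous_at isCont_def)
qed

text \<open>The derivatives on different triangles at the point have to be the same linear map \<open>L\<close>; then the
difference quotients have a common limit.\<close>

lemma has_derivative_at_triangles:
  fixes q :: "real \<times> real \<Rightarrow> real"
  assumes h: "h > 0"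
    and "\<And>i j. p \<in> tri h i j \<Longrightarrow> (q has_derivative L) (at p within tri h i j)"
    and "\<And>i j. p \<in> tri' h i j \<Longrightarrow> (q has_derivative L) (at p within tri' h i j)"
  shows "(q has_derivative L) (at p)"
proof -
  have "bounded_linear L"
    using triangles_cover[OF h, of p] assms(2,3) has_derivative_bounded_linear by blast
  then show ?thesis
    using assms(2,3) filterlim_at_triangles[OF h, of p _ "nhds 0"] unfolding has_derivative_at_within
    by blast
qed

section \<open>Smoothness of the quasi-interpolant\<close>


lemma C1_planeI:
  assumes "\<And>p. (f has_derivative (\<lambda>v. a p * fst v + b p * snd v)) (at p)"
    and "continuous_on UNIV a" "continuous_on UNIV b"
  shows "C1_plane f"
proof -
  define F S where "F = (Blinfun fst :: (real \<times> real) \<Rightarrow>\<^sub>L real)" and "S = (Blinfun snd :: (real \<times> real) \<Rightarrow>\<^sub>L real)"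
  have "blinfun_apply (a p *\<^sub>R F + b p *\<^sub>R S) = (\<lambda>v. a p * fst v + b p * snd v)" for p
    by (simp add: fun_eq_iff F_def S_def blinfun.add_left blinfun.scaleR_left bounded_linear_Blinfun_apply
        bounded_linear_fst bounded_linear_snd)
  then show ?thesis
    unfolding C1_plane_def
    by (intro exI[of _ "\<lambda>p. a p *\<^sub>R F + b p *\<^sub>R S"]) (auto simp: assms(1) intro!: continuous_intros assms(2,3))
qed

text \<open>The local gradients agree on the edges and so glue to a continuous field, which
is the gradient of the piecewise function at every point, vertices included.\<close>

lemma C1_plane_of_C1_net:
  assumes h: "h > 0" and N: "C1_net B" and q: "piecewise h (patch B) (patch' B) q"
  shows "C1_plane q"
proof -
  obtain Gs where Gs: "piecewise h (patch_s B) (patch'_s B) Gs"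
    using ex_piecewise[OF h, of "patch_s B" "patch'_s B"] gradients_match_if_C1_net[OF N] by auto
  obtain Gt where Gt: "piecewise h (patch_t B) (patch'_t B) Gt"
    using ex_piecewise[OF h, of "patch_t B" "patch'_t B"] gradients_match_if_C1_net[OF N] by auto
  have "continuous_on UNIV Gs" "continuous_on UNIV Gt"
    by (rule continuous_piecewise[OF h Gs] continuous_piecewise[OF h Gt];
        simp only: patch_s_def patch_t_def patch'_s_def patch'_t_def quadratic_form_def; intro continuous_intros)+
  then have cont: "continuous_on UNIV (\<lambda>p. (Gs p + Gt p) / (2 * h))" "continuous_on UNIV (\<lambda>p. (Gs p - Gt p) / (2 * h))"
    using h by (auto intro!: continuous_intros)
  have "(q has_derivative (\<lambda>v. Gs p * lat_s h v + Gt p * lat_t h v)) (at p)" for p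
  proof (rule has_derivative_at_triangles[OF h])
    fix i j
    have a: "((\<lambda>p. lat_s h p - of_int i) has_derivative lat_s h) (at p within S)"
         "((\<lambda>p. lat_t h p - of_int j) has_derivative lat_t h) (at p within S)" for S
      by (auto intro!: derivative_eq_intros)
    show "(q has_derivative (\<lambda>v. Gs p * lat_s h v + Gt p * lat_t h v)) (at p within tri h i j)" if "p \<in> tri h i j"
      unfolding piecewise_tri(1)[OF Gs that] piecewise_tri(1)[OF Gt that]
      by (rule has_derivative_transform[OF that piecewise_tri(1)[OF q] patch_has_derivative(1)[OF a, of B i j]])
    show "(q has_derivative (\<lambda>v. Gs p * lat_s h v + Gt p * lat_t h v)) (at p within tri' h i j)" if "p \<in> tri' h i j"
      unfolding piecewise_tri(2)[OF Gs that] piecewise_tri(2)[OF Gt that]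
      by (rule has_derivative_transform[OF that piecewise_tri(2)[OF q] patch_has_derivative(2)[OF a, of B i j]])
  qed
  moreover have "(\<lambda>v. Gs p * lat_s h v + Gt p * lat_t h v)
      = (\<lambda>v. (Gs p + Gt p) / (2 * h) * fst v + (Gs p - Gt p) / (2 * h) * snd v)" for p
    using h by (simp add: fun_eq_iff lat_s_def lat_t_def field_simps)
  ultimately show ?thesis
    using C1_planeI[OF _ cont] by simp
qed

lemma one_sided_derivatives_agree:
  fixes g :: "real \<Rightarrow> real"
  assumes g: "(g has_real_derivative d) (at 0)"
    and a: "(A has_real_derivative a) (at 0)" and b: "(B has_real_derivative b) (at 0)"
    and e: "e > 0" and A: "\<And>x. 0 \<le> x \<Longrightarrow> x < e \<Longrightarrow> g x = A x" and B: "\<And>x. - e < x \<Longrightarrow> x \<le> 0 \<Longrightarrow> g x = B x"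
  shows "a = b"
proof -
  have uniq: "d = c" if "(C has_real_derivative c) (at 0)" "at 0 within S \<noteq> bot" "0 \<in> S"
    "\<And>x. x \<in> S \<Longrightarrow> dist x 0 < e \<Longrightarrow> g x = C x" for C c S
  proof -
    have "(g has_real_derivative c) (at 0 within S)"
      using has_field_derivative_transform_within[of C c 0 S e g]
        has_field_derivative_at_within[OF that(1)] e that(3,4) by metis
    moreover have "(g has_real_derivative d) (at 0 within S)"
      using g by (rule has_field_derivative_at_within)
    ultimately show ?thesis
      using vector_derivative_unique_within[OF that(2)]
      by (metis has_real_derivative_iff_has_vector_derivative)
  qed
  have "d = a"
    by (rule uniq[OF a, of "{0..}"]) (auto simp: at_within_Ici_at_right A)
  moreover have "d = b"
    by (rule uniq[OF b, of "{..0}"]) (auto simp: at_within_Iic_at_left B)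
  ultimately show ?thesis by simp
qed

text \<open>On a line that crosses an edge the function is differentiable, while its one-sided derivatives are those of the two
adjacent cubics. The lines used are parallel to the edges of the triangulation.\<close>

lemma C1_net_of_C1_plane:
  assumes h: "h > 0" and C1: "C1_plane q" and q: "piecewise h (patch B) (patch' B) q"
  shows "C1_net B"
proof -
  obtain D where D: "\<And>p. (q has_derivative blinfun_apply (D p)) (at p)"
    using C1 unfolding C1_plane_def by blast
  have line: "((\<lambda>x. q (lat h (s + x * a) (t + x * b))) has_real_derivative D (lat h s t) (lat h a b)) (at 0)" for s t a b
  proof -
    have l: "((\<lambda>x. lat h (s + x * a) (t + x * b)) has_derivative (\<lambda>x. x *\<^sub>R lat h a b)) (at 0)"
      unfolding lat_def by (auto intro!: derivative_eq_intros simp: fun_eq_iff algebra_simps)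
    have "((\<lambda>x. q (lat h (s + x * a) (t + x * b))) has_derivative (\<lambda>x. D (lat h s t) (x *\<^sub>R lat h a b))) (at 0)"
      using has_derivative_compose[OF l, of q "D (lat h s t)"] D by simp
    then show ?thesis
      by (simp add: has_field_derivative_def blinfun.scaleR_right mult_commute_abs)
  qed
  have der: "((\<lambda>x. patch B i j (u + x * a) (w + x * b)) has_real_derivative
        patch_s B i j u w * a + patch_t B i j u w * b) (at 0)"
     "((\<lambda>x. patch' B i j (u + x * a) (w + x * b)) has_real_derivative
        patch'_s B i j u w * a + patch'_t B i j u w * b) (at 0)" for i j u w a b
  proof -
    have l: "((\<lambda>x. c + x * a) has_derivative (\<lambda>x. x * a)) (at 0)" for c a :: real
      by (auto intro!: derivative_eq_intros)
    show "((\<lambda>x. patch B i j (u + x * a) (w + x * b)) has_real_derivative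
        patch_s B i j u w * a + patch_t B i j u w * b) (at 0)"
      unfolding has_field_derivative_def
      by (rule has_derivative_eq_rhs, rule patch_has_derivative(1)[OF l l]) (simp add: fun_eq_iff algebra_simps)
    show "((\<lambda>x. patch' B i j (u + x * a) (w + x * b)) has_real_derivative
        patch'_s B i j u w * a + patch'_t B i j u w * b) (at 0)"
      unfolding has_field_derivative_def
      by (rule has_derivative_eq_rhs, rule patch_has_derivative(2)[OF l l]) (simp add: fun_eq_iff algebra_simps)
  qed
  note P = piecewiseD[OF q h]
  show ?thesis
  proof (rule C1_net_if_gradients_match)
    fix i j and u :: real assume u: "0 < u" "u < 1"
    \<comment> \<open>A step shorter than the distance from \<open>u\<close> to the ends of the edge stays within the two triangles.\<close>
    let ?e = "min u (1 - u)"
    show "patch_s B i j u u = patch'_s B i j u u"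
      using one_sided_derivatives_agree[OF line[of "of_int i + u" 1 "of_int j + u" 0]
          der(1)[of i j u 1 u 0] der(2)[of i j u 1 u 0], of ?e] u
        P(1)[of u "u + x" i j for x] P(2)[of "u + x" u i j for x]
      by (simp add: add.assoc)
    show "patch_t B i (j+1) u 0 = patch'_t B i j u 1"
    proof -
      have "q (lat h (of_int i + u) (of_int j + 1 + x)) = patch B i (j+1) u x" if "0 \<le> x" "x < ?e" for x
        using P(1)[of x u i "j+1"] that u by simp
      moreover have "q (lat h (of_int i + u) (of_int j + 1 + x)) = patch' B i j u (1 + x)" if "- ?e < x" "x \<le> 0" for x
        using P(2)[of u "1 + x" i j] that u by (simp add: add.assoc)
      ultimately show ?thesis
        using one_sided_derivatives_agree[OF line[of "of_int i + u" 0 "of_int j + 1" 1]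
          der(1)[of i "j+1" u 0 0 1] der(2)[of i j u 0 1 1], of ?e] u by simp
    qed
    show "patch_s B i j 1 u = patch'_s B (i+1) j 0 u"
    proof -
      have "q (lat h (of_int i + 1 + x) (of_int j + u)) = patch' B (i+1) j x u" if "0 \<le> x" "x < ?e" for x
        using P(2)[of x u "i+1" j] that u by simp
      moreover have "q (lat h (of_int i + 1 + x) (of_int j + u)) = patch B i j (1 + x) u" if "- ?e < x" "x \<le> 0" for x
        using P(1)[of u "1 + x" i j] that u by (simp add: add.assoc)
      ultimately show ?thesis
        using one_sided_derivatives_agree[OF line[of "of_int i + 1" 1 "of_int j + u" 0]
          der(2)[of "i+1" j 0 1 u 0] der(1)[of i j 1 1 u 0], of ?e] u by simp
    qed
  qed
qed

text \<open>The pieces are cubic polynomials in \<open>x\<close> and \<open>y\<close>: they are sums of products of three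
affine functions, and each affine factor raises the degree bound by one.\<close>

lemma poly2_deg_le_const: "poly2_deg_le d (\<lambda>p. k)"
  unfolding poly2_deg_le_def
proof (intro exI[of _ "\<lambda>a b. if a = 0 \<and> b = 0 then k else 0"] allI)
  fix x y :: real
  have "(\<Sum>a\<le>d. \<Sum>b\<le>d - a. (if a = 0 \<and> b = 0 then k else 0) * x ^ a * y ^ b)
      = (\<Sum>a\<le>d. if a = 0 then k else 0)"
  proof (intro sum.cong refl)
    fix a
    have "(\<Sum>b\<le>d - a. (if a = 0 \<and> b = 0 then k else 0) * x ^ a * y ^ b)
        = (\<Sum>b\<le>d - a. if b = 0 then (if a = 0 then k else 0) else 0)"
      by (intro sum.cong refl) auto
    then show "(\<Sum>b\<le>d - a. (if a = 0 \<and> b = 0 then k else 0) * x ^ a * y ^ b) = (if a = 0 then k else 0)"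
      by simp
  qed
  then show "k = (\<Sum>a\<le>d. \<Sum>b\<le>d - a. (if a = 0 \<and> b = 0 then k else 0) * x ^ a * y ^ b)" by simp
qed

lemma poly2_deg_le_add:
  assumes "poly2_deg_le d p" "poly2_deg_le d q"
  shows "poly2_deg_le d (\<lambda>x. p x + q x)"
proof -
  obtain c e where "\<And>x y. p (x, y) = (\<Sum>a\<le>d. \<Sum>b\<le>d - a. c a b * x ^ a * y ^ b)"
    "\<And>x y. q (x, y) = (\<Sum>a\<le>d. \<Sum>b\<le>d - a. e a b * x ^ a * y ^ b)"
    using assms unfolding poly2_deg_le_def by blast
  then show ?thesis
    unfolding poly2_deg_le_def
    by (intro exI[of _ "\<lambda>a b. c a b + e a b"]) (simp add: sum.distrib algebra_simps)
qed

lemma poly2_deg_le_cmult: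
  assumes "poly2_deg_le d p"
  shows "poly2_deg_le d (\<lambda>x. k * p x)"
proof -
  obtain c where "\<And>x y. p (x, y) = (\<Sum>a\<le>d. \<Sum>b\<le>d - a. c a b * x ^ a * y ^ b)"
    using assms unfolding poly2_deg_le_def by blast
  then show ?thesis
    unfolding poly2_deg_le_def
    by (intro exI[of _ "\<lambda>a b. k * c a b"]) (simp add: sum_distrib_left algebra_simps)
qed

lemma poly2_deg_le_fst_mult:
  assumes "poly2_deg_le d p"
  shows "poly2_deg_le (Suc d) (\<lambda>x. fst x * p x)"
proof -
  obtain c where c: "\<And>x y. p (x, y) = (\<Sum>a\<le>d. \<Sum>b\<le>d - a. c a b * x ^ a * y ^ b)"
    using assms unfolding poly2_deg_le_def by blast
  show ?thesis
    unfolding poly2_deg_le_def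
    by (intro exI[of _ "\<lambda>a b. case a of 0 \<Rightarrow> 0 | Suc a' \<Rightarrow> c a' b"])
       (simp add: c sum.atMost_Suc_shift sum_distrib_left algebra_simps del: sum.atMost_Suc)
qed

lemma poly2_deg_le_Suc:
  assumes "poly2_deg_le d p"
  shows "poly2_deg_le (Suc d) p"
proof -
  obtain c where c: "\<And>x y. p (x, y) = (\<Sum>a\<le>d. \<Sum>b\<le>d - a. c a b * x ^ a * y ^ b)"
    using assms unfolding poly2_deg_le_def by blast
  have "(\<Sum>a\<le>Suc d. \<Sum>b\<le>Suc d - a. (if a + b \<le> d then c a b else 0) * x ^ a * y ^ b)
      = (\<Sum>a\<le>d. \<Sum>b\<le>d - a. c a b * x ^ a * y ^ b)" for x y :: real
  proof -
    have "(\<Sum>b\<le>Suc d - a. (if a + b \<le> d then c a b else 0) * x ^ a * y ^ b)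
        = (\<Sum>b\<le>d - a. c a b * x ^ a * y ^ b)" if "a \<le> d" for a
      using that by (simp add: Suc_diff_le) (auto intro!: sum.cong)
    then show ?thesis by simp
  qed
  then show ?thesis
    unfolding poly2_deg_le_def using c by (intro exI[of _ "\<lambda>a b. if a + b \<le> d then c a b else 0"]) simp
qed

lemma poly2_deg_le_snd_mult:
  assumes "poly2_deg_le d p"
  shows "poly2_deg_le (Suc d) (\<lambda>x. snd x * p x)"
proof -
  obtain c where c: "\<And>x y. p (x, y) = (\<Sum>a\<le>d. \<Sum>b\<le>d - a. c a b * x ^ a * y ^ b)"
    using assms unfolding poly2_deg_le_def by blast
  show ?thesis
    unfolding poly2_deg_le_def
  proof (intro exI[of _ "\<lambda>a b. case b of 0 \<Rightarrow> 0 | Suc b' \<Rightarrow> c a b'"] allI)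
    fix x y :: real
    have "(\<Sum>b\<le>Suc d - a. (case b of 0 \<Rightarrow> 0 | Suc b' \<Rightarrow> c a b') * x ^ a * y ^ b)
        = (\<Sum>b\<le>d - a. c a b * x ^ a * y ^ b) * y" if "a \<le> d" for a
      using that by (simp add: Suc_diff_le sum.atMost_Suc_shift sum_distrib_left algebra_simps del: sum.atMost_Suc)
    then have "(\<Sum>a\<le>Suc d. \<Sum>b\<le>Suc d - a. (case b of 0 \<Rightarrow> 0 | Suc b' \<Rightarrow> c a b') * x ^ a * y ^ b)
        = (\<Sum>a\<le>d. (\<Sum>b\<le>d - a. c a b * x ^ a * y ^ b) * y)" by simp
    also have "\<dots> = p (x, y) * y" by (simp only: c sum_distrib_right)
    finally show "snd (x, y) * p (x, y) = (\<Sum>a\<le>Suc d. \<Sum>b\<le>Suc d - a. (case b of 0 \<Rightarrow> 0 | Suc b' \<Rightarrow> c a b') * x ^ a * y ^ b)"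
      by simp
  qed
qed

lemma poly2_deg_le_affine_mult:
  assumes "poly2_deg_le d p"
  shows "poly2_deg_le (Suc d) (\<lambda>x. (\<alpha> * lat_s h x + \<beta> * lat_t h x + \<gamma>) * p x)"
proof -
  have "(\<lambda>x. (\<alpha> * lat_s h x + \<beta> * lat_t h x + \<gamma>) * p x)
    = (\<lambda>x. (\<alpha> / (2 * h) + \<beta> / (2 * h)) * (fst x * p x) + (\<alpha> / (2 * h) - \<beta> / (2 * h)) * (snd x * p x) + \<gamma> * p x)"
    by (simp add: lat_s_def lat_t_def algebra_simps add_divide_distrib diff_divide_distrib)
  then show ?thesis
    using poly2_deg_le_fst_mult[OF assms] poly2_deg_le_snd_mult[OF assms] poly2_deg_le_Suc[OF assms]
    by (simp add: poly2_deg_le_add poly2_deg_le_cmult)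
qed

lemma poly2_deg_le_cubic_form:
  fixes h :: real
  defines "L \<equiv> \<lambda>(\<alpha>, \<beta>, \<gamma>) p. \<alpha> * lat_s h p + \<beta> * lat_t h p + \<gamma>"
  shows "poly2_deg_le 3 (\<lambda>p. cubic_form a b c d e f g k l m (L x p) (L y p) (L z p))"
proof -
  have "poly2_deg_le (Suc d) (\<lambda>p. L x p * q p)" if "poly2_deg_le d q" for x d q
    using poly2_deg_le_affine_mult[OF that] unfolding L_def by (cases x) simp
  then have "poly2_deg_le (Suc (Suc (Suc 0))) (\<lambda>p. L x p * (L y p * (L z p * k)))" for x y z k
    using poly2_deg_le_const by blast
  then have t: "poly2_deg_le 3 (\<lambda>p. L x p * (L y p * (L z p * k)))" for x y z k
    by (simp add: numeral_3_eq_3)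
  have e: "cubic_form a b c d e f g k l m X Y Z = X * (X * (X * a)) + X * (X * (Y * (3 * b))) + X * (X * (Z * (3 * c)))
      + X * (Y * (Y * (3 * d))) + X * (Y * (Z * (6 * e))) + X * (Z * (Z * (3 * f))) + Y * (Y * (Y * g))
      + Y * (Y * (Z * (3 * k))) + Y * (Z * (Z * (3 * l))) + Z * (Z * (Z * m))" for X Y Z
    by (simp add: cubic_form_def power2_eq_square power3_eq_cube algebra_simps)
  show ?thesis unfolding e by (intro poly2_deg_le_add t)
qed

lemma poly2_deg_le_patch:
  "poly2_deg_le 3 (\<lambda>p. patch B i j (lat_s h p - a) (lat_t h p - b))"
  "poly2_deg_le 3 (\<lambda>p. patch' B i j (lat_s h p - a) (lat_t h p - b))"
proof -
  note P = poly2_deg_le_cubic_form[where h = h]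
  show "poly2_deg_le 3 (\<lambda>p. patch B i j (lat_s h p - a) (lat_t h p - b))"
    using P[where x = "(-1, 0, 1 + a)" and y = "(0, 1, - b)" and z = "(1, -1, b - a)"]
    unfolding patch_def by (simp add: algebra_simps)
  show "poly2_deg_le 3 (\<lambda>p. patch' B i j (lat_s h p - a) (lat_t h p - b))"
    using P[where x = "(-1, 1, a - b)" and y = "(1, 0, - a)" and z = "(0, -1, 1 + b)"]
    unfolding patch'_def by (simp add: algebra_simps)
qed

lemma quasi_interp_spline_iff:
  assumes h: "h > 0"
  shows "quasi_interp h M f \<in> spline31 h \<longleftrightarrow> C1_net (bb_coeff h M f)"
proof -
  have q: "piecewise h (patch (bb_coeff h M f)) (patch' (bb_coeff h M f)) (quasi_interp h M f)"
    using is_quasi_interpolant_quasi_interp[OF h] is_quasi_interpolant_iff_piecewise[OF h] by blast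
  have "(\<exists>p. poly2_deg_le 3 p \<and> (\<forall>z\<in>tri h i j. quasi_interp h M f z = p z)) \<and>
        (\<exists>p. poly2_deg_le 3 p \<and> (\<forall>z\<in>tri' h i j. quasi_interp h M f z = p z))" for i j
    using poly2_deg_le_patch piecewise_tri[OF q] by blast
  then show ?thesis
    unfolding spline31_def using C1_plane_of_C1_net[OF h _ q] C1_net_of_C1_plane[OF h _ q] by blast
qed

section \<open>Prescribing the data at a single vertex\<close>


lemma partials_of_has_derivative:
  assumes "(f has_derivative (\<lambda>v. a * fst v + b * snd v)) (at p)"
  shows "partial_x f p = a" "partial_y f p = b"
proof -
  have x: "((\<lambda>t. (t, snd p)) has_derivative (\<lambda>v. (v, 0))) (at (fst p))"
    and y: "((\<lambda>t. (fst p, t)) has_derivative (\<lambda>v. (0, v))) (at (snd p))"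
    by (intro has_derivative_Pair has_derivative_ident has_derivative_const)+
  have f: "(f has_derivative (\<lambda>v. a * fst v + b * snd v)) (at (fst p, snd p))"
    using assms by simp
  show "partial_x f p = a"
    unfolding partial_x_def
    using has_derivative_compose[OF x f] by (intro DERIV_imp_deriv) (simp add: has_field_derivative_def)
  show "partial_y f p = b"
    unfolding partial_y_def
    using has_derivative_compose[OF y f] by (intro DERIV_imp_deriv) (simp add: has_field_derivative_def)
qed

lemma max_square_deriv: "((\<lambda>z::real. (max 0 z)\<^sup>2) has_real_derivative 2 * max 0 z) (at z)"
proof (rule linorder_cases[of z 0])
  assume "z < 0"
  have "((\<lambda>z::real. (max 0 z)\<^sup>2) has_real_derivative 0) (at z)"
    by (rule has_field_derivative_transform_within_open[of "\<lambda>_. 0" 0 z "{..<0}"]) (use \<open>z < 0\<close> in auto)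
  then show ?thesis using \<open>z < 0\<close> by simp
next
  assume "z > 0"
  have "((\<lambda>z::real. (max 0 z)\<^sup>2) has_real_derivative 2 * z) (at z)"
    by (rule has_field_derivative_transform_within_open[of "\<lambda>z. z\<^sup>2" "2 * z" z "{0<..}"])
       (use \<open>z > 0\<close> in \<open>auto intro!: derivative_eq_intros\<close>)
  then show ?thesis using \<open>z > 0\<close> by simp
next
  assume z: "z = 0"
  have "((\<lambda>h::real. max 0 h) \<longlongrightarrow> max 0 0) (at 0)" by (intro tendsto_intros)
  then have "((\<lambda>h::real. (max 0 h)\<^sup>2 / h) \<longlongrightarrow> max 0 0) (at 0)"
    by (rule Lim_transform_within[OF _ zero_less_one]) (auto simp: max_def power2_eq_square)
  then show ?thesis unfolding z by (simp add: DERIV_def)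
qed

text \<open>The first factor is a continuously differentiable cut-off that equals 1 with vanishing gradient at the origin and
is supported in the disc of radius \<open>h\<close>. The second factor is affine and carries the prescribed value
\<open>k0\<close> and the scaled derivatives \<open>k1\<close>, \<open>k2\<close>.\<close>

definition bump :: "real \<Rightarrow> real \<Rightarrow> real \<Rightarrow> real \<Rightarrow> real \<times> real \<Rightarrow> real" where
  "bump h k0 k1 k2 p = (max 0 (1 - ((fst p)\<^sup>2 + (snd p)\<^sup>2) / h\<^sup>2))\<^sup>2 * (k0 + k1 * (fst p / h) + k2 * (snd p / h))"

text \<open>One formula for both partial derivatives: \<open>xi\<close> is the coordinate projection and \<open>k\<close> the corresponding
coefficient of the affine factor.\<close>

definition bump_grad :: "real \<Rightarrow> real \<Rightarrow> real \<Rightarrow> real \<Rightarrow> real \<Rightarrow> (real \<times> real \<Rightarrow> real) \<Rightarrow> real \<times> real \<Rightarrow> real" where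
  "bump_grad h k0 k1 k2 k xi p =
     2 * max 0 (1 - ((fst p)\<^sup>2 + (snd p)\<^sup>2) / h\<^sup>2) * (- 2 * xi p / h\<^sup>2) * (k0 + k1 * (fst p / h) + k2 * (snd p / h))
     + (max 0 (1 - ((fst p)\<^sup>2 + (snd p)\<^sup>2) / h\<^sup>2))\<^sup>2 * (k / h)"

lemma bump_has_derivative:
  assumes "h > 0"
  shows "(bump h k0 k1 k2 has_derivative
    (\<lambda>v. bump_grad h k0 k1 k2 k1 fst p * fst v + bump_grad h k0 k1 k2 k2 snd p * snd v)) (at p)"
proof -
  let ?z = "\<lambda>p. 1 - ((fst p)\<^sup>2 + (snd p)\<^sup>2) / h\<^sup>2"
  have z: "(?z has_derivative (\<lambda>v. - (2 * fst p * fst v + 2 * snd p * snd v) / h\<^sup>2)) (at p)"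
    using assms by (auto intro!: derivative_eq_intros simp: fun_eq_iff field_simps)
  have "((\<lambda>p. (max 0 (?z p))\<^sup>2) has_derivative
      (\<lambda>v. 2 * max 0 (?z p) * (- (2 * fst p * fst v + 2 * snd p * snd v) / h\<^sup>2))) (at p)"
    using has_derivative_compose[OF z max_square_deriv[unfolded has_field_derivative_def]] by simp
  moreover have "((\<lambda>p. k0 + k1 * (fst p / h) + k2 * (snd p / h)) has_derivative (\<lambda>v. k1 * (fst v / h) + k2 * (snd v / h))) (at p)"
    using assms by (auto intro!: derivative_eq_intros)
  ultimately have "((\<lambda>p. (max 0 (?z p))\<^sup>2 * (k0 + k1 * (fst p / h) + k2 * (snd p / h))) has_derivative
     (\<lambda>v. (max 0 (?z p))\<^sup>2 * (k1 * (fst v / h) + k2 * (snd v / h)) +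
       2 * max 0 (?z p) * (- (2 * fst p * fst v + 2 * snd p * snd v) / h\<^sup>2) * (k0 + k1 * (fst p / h) + k2 * (snd p / h)))) (at p)"
    by (rule has_derivative_mult)
  then show ?thesis
    unfolding bump_def[abs_def] bump_grad_def
    by (rule has_derivative_eq_rhs) (simp add: fun_eq_iff algebra_simps add_divide_distrib diff_divide_distrib)
qed

lemma C1_plane_bump: 
  assumes "h > 0" shows "C1_plane (bump h k0 k1 k2)"
  by (rule C1_planeI[OF bump_has_derivative[OF assms]])
     (use assms in \<open>simp_all only: bump_grad_def, auto intro!: continuous_intros\<close>)

text \<open>All vertices other than the origin lie at distance at least \<open>sqrt 2 * h\<close> from it, hence outside the support.\<close>

lemma bump_jet:
  assumes h: "h > 0"
  shows "bump h k0 k1 k2 (vtx h i j) = (if i = 0 \<and> j = 0 then k0 else 0)"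
    "h * partial_x (bump h k0 k1 k2) (vtx h i j) = (if i = 0 \<and> j = 0 then k1 else 0)"
    "h * partial_y (bump h k0 k1 k2) (vtx h i j) = (if i = 0 \<and> j = 0 then k2 else 0)"
proof -
  let ?p = "vtx h i j"
  have far: "max 0 (1 - ((fst ?p)\<^sup>2 + (snd ?p)\<^sup>2) / h\<^sup>2) = 0" if "\<not> (i = 0 \<and> j = 0)"
  proof -
    have "(fst ?p)\<^sup>2 + (snd ?p)\<^sup>2 = of_int (2 * (i\<^sup>2 + j\<^sup>2)) * h\<^sup>2"
      by (simp add: vtx_def power2_eq_square algebra_simps)
    moreover have "i\<^sup>2 + j\<^sup>2 > 0" using that by (simp add: sum_power2_gt_zero_iff)
    then have "1 \<le> i\<^sup>2 + j\<^sup>2" by (simp only: int_one_le_iff_zero_less)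
    then have "(1::real) \<le> of_int (i\<^sup>2 + j\<^sup>2)" by (metis of_int_1 of_int_le_iff)
    then have "(1::real) \<le> of_int (2 * (i\<^sup>2 + j\<^sup>2))" by simp
    ultimately show ?thesis using h by simp
  qed
  show "bump h k0 k1 k2 ?p = (if i = 0 \<and> j = 0 then k0 else 0)"
    using far by (auto simp: bump_def vtx_def)
  show "h * partial_x (bump h k0 k1 k2) ?p = (if i = 0 \<and> j = 0 then k1 else 0)"
    "h * partial_y (bump h k0 k1 k2) ?p = (if i = 0 \<and> j = 0 then k2 else 0)"
    using far h unfolding partials_of_has_derivative[OF bump_has_derivative[OF h]]
    by (auto simp: bump_grad_def vtx_def)
qed

section \<open>Masks that produce splines\<close>


lemma distinct_7: "distinct [0, 1, 2, 3, 4, 5, 6 :: 7]"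
  by (simp add: bit1.Rep_inject_sym bit1.Rep_numeral bit1.Rep_0 bit1.Rep_1)

lemma UNIV_7: "(UNIV :: 7 set) = {0, 1, 2, 3, 4, 5, 6}"
proof -
  have "card (set [0, 1, 2, 3, 4, 5, 6 :: 7]) = card (UNIV :: 7 set)"
    unfolding distinct_card[OF distinct_7] by simp
  then have "set [0, 1, 2, 3, 4, 5, 6 :: 7] = UNIV"
    by (intro card_subset_eq) simp_all
  then show ?thesis by simp
qed

lemma sum_7: "(\<Sum>k\<in>(UNIV :: 7 set). g k) = g 0 + g 1 + g 2 + g 3 + g 4 + g 5 + g 6"
  using distinct_7 unfolding UNIV_7 by (simp add: add.assoc)

definition offset :: "7 \<Rightarrow> int \<times> int" where
  "offset k = (if k = 0 then (0, 0) else if k = 1 then (1, 1) else if k = 2 then (1, 0)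
    else if k = 3 then (0, -1) else if k = 4 then (-1, -1) else if k = 5 then (-1, 0) else (0, 1))"

lemma offset_simps [simp]:
  "offset 0 = (0, 0)" "offset 1 = (1, 1)" "offset 2 = (1, 0)" "offset 3 = (0, -1)"
  "offset 4 = (-1, -1)" "offset 5 = (-1, 0)" "offset 6 = (0, 1)"
  using distinct_7 by (auto simp: offset_def)

lemma stencil_nth: "stencil h g i j $ k = g (vtx h (i + fst (offset k)) (j + snd (offset k)))"
  by (simp add: stencil_def offset_def)

lemma bb_coeff_offset:
  "bb_coeff h M f c i j =
     (\<Sum>k\<in>UNIV. M $ (c, J00) $ k * f (vtx h (i + fst (offset k)) (j + snd (offset k)))) +
     (\<Sum>k\<in>UNIV. M $ (c, J10) $ k * (h * partial_x f (vtx h (i + fst (offset k)) (j + snd (offset k))))) +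
     (\<Sum>k\<in>UNIV. M $ (c, J01) $ k * (h * partial_y f (vtx h (i + fst (offset k)) (j + snd (offset k)))))"
  by (simp add: bb_coeff_def inner_vec_def stencil_nth)

text \<open>The net of Bernstein ordinates that one column of the masks produces from a unit datum at
the origin: the entry for a stencil position contributes at the vertex from which the origin
is seen in that position.\<close>

definition mask_net :: "(coefficient \<Rightarrow> real ^ 7) \<Rightarrow> net" where
  "mask_net v c i j = (\<Sum>k\<in>UNIV. if i + fst (offset k) = 0 \<and> j + snd (offset k) = 0 then v c $ k else 0)"

lemma bb_coeff_bump:
  assumes "h > 0"
  shows "bb_coeff h M (bump h k0 k1 k2) c i j =
    k0 * mask_net (\<lambda>c. M $ (c, J00)) c i j + k1 * mask_net (\<lambda>c. M $ (c, J10)) c i j + k2 * mask_net (\<lambda>c. M $ (c, J01)) c i j"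
  unfolding bb_coeff_offset bump_jet[OF assms] mask_net_def sum_distrib_left
  by (intro arg_cong2[of _ _ _ _ "(+)"] sum.cong) (auto simp: sum_7)

text \<open>Applying the operator to a bump with a single nonzero datum isolates one column.\<close>

lemma C1_mask_net:
  assumes h: "h > 0" and M: "maps_to_splines h M"
  shows "C1_net (mask_net (\<lambda>c. M $ (c, J)))"
proof -
  have N: "C1_net (bb_coeff h M (bump h k0 k1 k2))" for k0 k1 k2
    using M C1_plane_bump[OF h] quasi_interp_spline_iff[OF h] unfolding maps_to_splines_def by blast
  have "bb_coeff h M (bump h (if J = J00 then 1 else 0) (if J = J10 then 1 else 0) (if J = J01 then 1 else 0))
      = mask_net (\<lambda>c. M $ (c, J))"
    by (intro ext, unfold bb_coeff_bump[OF h]) (cases J; simp)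
  then show ?thesis using N by metis
qed

section \<open>Exactness on quadratics as moment conditions\<close>

text \<open>The basis of the quadratics in lattice coordinates, with its two partial derivatives.\<close>

definition quad_mono :: "nat \<Rightarrow> real \<Rightarrow> real \<Rightarrow> real" where
  "quad_mono n s t = [1, s, t, s\<^sup>2, s * t, t\<^sup>2] ! n"
definition quad_mono_s :: "nat \<Rightarrow> real \<Rightarrow> real \<Rightarrow> real" where
  "quad_mono_s n s t = [0, 1, 0, 2 * s, t, 0] ! n"
definition quad_mono_t :: "nat \<Rightarrow> real \<Rightarrow> real \<Rightarrow> real" where
  "quad_mono_t n s t = [0, 0, 1, 0, s, 2 * t] ! n"

lemma sum_6: "(\<Sum>n<6::nat. g n) = g 0 + g 1 + g 2 + g 3 + g 4 + (g 5 :: real)"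
  by (simp add: eval_nat_numeral)

definition lat_quad :: "real \<Rightarrow> (nat \<Rightarrow> real) \<Rightarrow> real \<times> real \<Rightarrow> real" where
  "lat_quad h a p = (\<Sum>n<6. a n * quad_mono n (lat_s h p) (lat_t h p))"

lemma poly2_deg_le_2_iff:
  assumes h: "h > 0"
  shows "poly2_deg_le 2 p \<longleftrightarrow> (\<exists>a. p = lat_quad h a)"
proof
  assume "poly2_deg_le 2 p"
  then obtain c where c: "\<And>x y. p (x, y) = (\<Sum>a\<le>2. \<Sum>b\<le>2 - a. c a b * x ^ a * y ^ b)"
    unfolding poly2_deg_le_def by blast
  define a where "a n = [c 0 0, h * (c 1 0 + c 0 1), h * (c 1 0 - c 0 1), h\<^sup>2 * (c 2 0 + c 1 1 + c 0 2),
      h\<^sup>2 * (2 * c 2 0 - 2 * c 0 2), h\<^sup>2 * (c 2 0 - c 1 1 + c 0 2)] ! n" for n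
  have "p z = lat_quad h a z" for z
  proof -
    obtain s t where z: "z = lat h s t" using lat_coords(1)[OF h] by metis
    have "p (lat h s t) = (\<Sum>n<6. a n * quad_mono n s t)"
      unfolding sum_6 lat_def
      by (simp add: c a_def quad_mono_def numeral_2_eq_2) (simp add: power2_eq_square algebra_simps)
    then show ?thesis by (simp add: z lat_quad_def lat_coords[OF h])
  qed
  then show "\<exists>a. p = lat_quad h a" by blast
next
  assume "\<exists>a. p = lat_quad h a"
  then obtain a where a: "p = lat_quad h a" ..
  have 1: "poly2_deg_le (Suc 0) (\<lambda>x. lat_s h x * k)" "poly2_deg_le (Suc 0) (\<lambda>x. lat_t h x * k)" for k
    using poly2_deg_le_affine_mult[OF poly2_deg_le_const, of 0 1 h 0 0 k]
      poly2_deg_le_affine_mult[OF poly2_deg_le_const, of 0 0 h 1 0 k] by simp_all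
  have 2: "poly2_deg_le 2 (\<lambda>x. lat_s h x * q x)" "poly2_deg_le 2 (\<lambda>x. lat_t h x * q x)"
    if "poly2_deg_le (Suc 0) q" for q
    using poly2_deg_le_affine_mult[OF that, of 1 h 0 0] poly2_deg_le_affine_mult[OF that, of 0 h 1 0]
    by (simp_all add: numeral_2_eq_2)
  have "p = (\<lambda>x. a 0 + lat_s h x * (a 1 + lat_s h x * a 3 + lat_t h x * a 4) + lat_t h x * (a 2 + lat_t h x * a 5))"
    by (simp add: a lat_quad_def sum_6 quad_mono_def fun_eq_iff power2_eq_square algebra_simps)
  then show "poly2_deg_le 2 p"
    by (auto intro!: poly2_deg_le_add 2 1 poly2_deg_le_const)
qed

lemma lat_quad_jet:
  assumes h: "h > 0"
  shows "lat_quad h a (vtx h i j) = (\<Sum>n<6. a n * quad_mono n i j)"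
    "h * partial_x (lat_quad h a) (vtx h i j) = (\<Sum>n<6. a n * ((quad_mono_s n i j + quad_mono_t n i j) / 2))"
    "h * partial_y (lat_quad h a) (vtx h i j) = (\<Sum>n<6. a n * ((quad_mono_s n i j - quad_mono_t n i j) / 2))"
proof -
  have v: "vtx h i j = lat h i j" by (simp add: vtx_def lat_def)
  show "lat_quad h a (vtx h i j) = (\<Sum>n<6. a n * quad_mono n i j)"
    by (simp add: lat_quad_def v lat_coords[OF h])
  let ?s = "\<Sum>n<6. a n * quad_mono_s n i j" and ?t = "\<Sum>n<6. a n * quad_mono_t n i j"
  have "(lat_quad h a has_derivative (\<lambda>v. ?s * lat_s h v + ?t * lat_t h v)) (at (vtx h i j))"
    unfolding lat_quad_def[abs_def] sum_6 quad_mono_def quad_mono_s_def quad_mono_t_def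
    by (auto intro!: derivative_eq_intros simp: fun_eq_iff v lat_coords[OF h] algebra_simps)
  then have "(lat_quad h a has_derivative (\<lambda>v. (?s + ?t) / (2 * h) * fst v + (?s - ?t) / (2 * h) * snd v)) (at (vtx h i j))"
    by (rule has_derivative_eq_rhs) (simp add: fun_eq_iff lat_s_def lat_t_def add_divide_distrib diff_divide_distrib algebra_simps)
  note P = partials_of_has_derivative[OF this]
  show "h * partial_x (lat_quad h a) (vtx h i j) = (\<Sum>n<6. a n * ((quad_mono_s n i j + quad_mono_t n i j) / 2))"
    "h * partial_y (lat_quad h a) (vtx h i j) = (\<Sum>n<6. a n * ((quad_mono_s n i j - quad_mono_t n i j) / 2))"
    unfolding P using h by (simp_all add: sum_6 algebra_simps add_divide_distrib diff_divide_distrib)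
qed

text \<open>The coefficients of the same quadratic re-expanded about the point \<open>(s, t)\<close>.\<close>

definition taylor :: "(nat \<Rightarrow> real) \<Rightarrow> real \<Rightarrow> real \<Rightarrow> nat \<Rightarrow> real" where
  "taylor a s t n = [\<Sum>m<6. a m * quad_mono m s t, \<Sum>m<6. a m * quad_mono_s m s t, \<Sum>m<6. a m * quad_mono_t m s t, a 3, a 4, a 5] ! n"

lemma taylor_expansion:
  "(\<Sum>n<6. a n * quad_mono n (i + s) (j + t)) = (\<Sum>n<6. taylor a i j n * quad_mono n s t)"
  "(\<Sum>n<6. a n * quad_mono_s n (i + s) (j + t)) = (\<Sum>n<6. taylor a i j n * quad_mono_s n s t)"
  "(\<Sum>n<6. a n * quad_mono_t n (i + s) (j + t)) = (\<Sum>n<6. taylor a i j n * quad_mono_t n s t)"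
  unfolding sum_6 taylor_def quad_mono_def quad_mono_s_def quad_mono_t_def
  by (simp_all add: power2_eq_square algebra_simps)

text \<open>The ordinate functional at the origin applied to a basis quadratic. Since \<open>x = h (s + t)\<close> and \<open>y = h (s - t)\<close>, the
scaled partial derivatives are half the sum and half the difference of the lattice derivatives.\<close>

definition moment :: "masks \<Rightarrow> coefficient \<Rightarrow> nat \<Rightarrow> real" where
  "moment M c n = (\<Sum>k\<in>UNIV. let x = of_int (fst (offset k)); y = of_int (snd (offset k)) in
     M $ (c, J00) $ k * quad_mono n x y
     + M $ (c, J10) $ k * ((quad_mono_s n x y + quad_mono_t n x y) / 2)
     + M $ (c, J01) $ k * ((quad_mono_s n x y - quad_mono_t n x y) / 2))"

text \<open>By Taylor expansion about \<open>v\<^sub>i\<^sub>,\<^sub>j\<close> the ordinate there depends on the quadratic only through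
its local coefficients, with the same moments at every vertex.\<close>

lemma bb_coeff_lat_quad:
  assumes h: "h > 0"
  shows "bb_coeff h M (lat_quad h a) c i j = (\<Sum>n<6. taylor a i j n * moment M c n)"
proof -
  have t: "(\<Sum>n<6. a n * ((quad_mono_s n (i + s) (j + t) + quad_mono_t n (i + s) (j + t)) / 2))
      = (\<Sum>n<6. taylor a i j n * ((quad_mono_s n s t + quad_mono_t n s t) / 2))"
    "(\<Sum>n<6. a n * ((quad_mono_s n (i + s) (j + t) - quad_mono_t n (i + s) (j + t)) / 2))
      = (\<Sum>n<6. taylor a i j n * ((quad_mono_s n s t - quad_mono_t n s t) / 2))" for s t :: real
    using taylor_expansion(2,3)[of a i s j t]
    by (simp_all add: sum.distrib sum_subtractf algebra_simps flip: sum_divide_distrib)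
  show ?thesis
    unfolding bb_coeff_offset lat_quad_jet[OF h] of_int_add taylor_expansion(1) t moment_def Let_def
    by (simp add: sum.distrib sum_distrib_left sum.swap[of _ "{..<6}"] algebra_simps)
qed

text \<open>The Bernstein ordinate of a cubic at a domain point is its blossom (symmetric trilinear polar form) at the three corners
that make up the point. For the basis quadratics this gives: at \<open>(0, 0)\<close> three times for a vertex, at \<open>(0, 0)\<close> twice
and the other end \<open>d\<close> for an edge, and at the three corners of the triangle for a centre.\<close>

definition blossom_moment :: "coefficient \<Rightarrow> nat \<Rightarrow> real" where
  "blossom_moment c n = (case c of Vert \<Rightarrow> [1, 0, 0, 0, 0, 0]
     | Edge d \<Rightarrow> [1, of_int (fst (dir_vec d)) / 3, of_int (snd (dir_vec d)) / 3, 0, 0, 0]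
     | Cen \<Rightarrow> [1, 2/3, 1/3, 1/3, 1/6, 0]
     | Cen' \<Rightarrow> [1, 1/3, 2/3, 0, 1/6, 1/3]) ! n"

definition quad_net :: "(nat \<Rightarrow> real) \<Rightarrow> net" where
  "quad_net a c i j = (\<Sum>n<6. taylor a i j n * blossom_moment c n)"

lemma taylor_shift: "n < 6 \<Longrightarrow> taylor (taylor a i j) s t n = taylor a (i + s) (j + t) n"
proof -
  assume "n < 6"
  then have n: "n \<in> {0, 1, 2, 3, 4, 5}" by auto
  have t: "taylor a s t 0 = (\<Sum>m<6. a m * quad_mono m s t)" "taylor a s t (Suc 0) = (\<Sum>m<6. a m * quad_mono_s m s t)"
    "taylor a s t 2 = (\<Sum>m<6. a m * quad_mono_t m s t)" "taylor a s t 3 = a 3" "taylor a s t 4 = a 4" "taylor a s t 5 = a 5" for a s t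
    by (simp_all add: taylor_def)
  show ?thesis using n by (auto simp: t taylor_expansion)
qed

text \<open>After re-expansion at \<open>v\<^sub>i\<^sub>,\<^sub>j\<close> only the identity on the two triangles at the origin remains.\<close>

lemma patch_quad_net:
  "patch (quad_net a) i j u w = (\<Sum>n<6. a n * quad_mono n (i + u) (j + w))"
  "patch' (quad_net a) i j u w = (\<Sum>n<6. a n * quad_mono n (i + u) (j + w))"
proof -
  define A where "A = taylor a i j"
  have q: "quad_net a c (i + s) (j + t) = quad_net A c s t" for c s t
    unfolding quad_net_def A_def by (intro sum.cong refl) (simp add: taylor_shift)
  have shift: "patch (quad_net a) i j u w = patch (quad_net A) 0 0 u w"
    "patch' (quad_net a) i j u w = patch' (quad_net A) 0 0 u w"
    using q[where s = 0] q[where t = 0] q[where s = 0 and t = 0] q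
    by (simp_all add: patch_def patch'_def)
  have "patch (quad_net A) 0 0 u w = (\<Sum>n<6. A n * quad_mono n u w)"
    "patch' (quad_net A) 0 0 u w = (\<Sum>n<6. A n * quad_mono n u w)"
    unfolding patch_def patch'_def cubic_form_def quad_net_def blossom_moment_def sum_6 taylor_def quad_mono_def quad_mono_s_def quad_mono_t_def
    by (simp_all add: power2_eq_square power3_eq_cube algebra_simps add_divide_distrib)
  then show "patch (quad_net a) i j u w = (\<Sum>n<6. a n * quad_mono n (i + u) (j + w))"
    "patch' (quad_net a) i j u w = (\<Sum>n<6. a n * quad_mono n (i + u) (j + w))"
    unfolding shift taylor_expansion A_def by simp_all
qed

lemma piecewise_quad_net:
  "h > 0 \<Longrightarrow> piecewise h (patch (quad_net a)) (patch' (quad_net a)) (lat_quad h a)"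
  by (simp add: piecewise_def patch_quad_net lat_quad_def)

text \<open>The ten domain points of the triangle are unisolvent: the corners give the corner coefficients, the two interior points
of each edge then the edge coefficients, and the barycentre the central one.\<close>

lemma cubic_form_unique:
  assumes "\<And>x y z. 0 \<le> x \<Longrightarrow> 0 \<le> y \<Longrightarrow> 0 \<le> z \<Longrightarrow> x + y + z = 1 \<Longrightarrow>
    cubic_form a b c d e f g k l m x y z = cubic_form a' b' c' d' e' f' g' k' l' m' x y z"
  shows "a = a'" "b = b'" "c = c'" "d = d'" "e = e'" "f = f'" "g = g'" "k = k'" "l = l'" "m = m'"
proof -
  note [simp] = cubic_form_def power2_eq_square power3_eq_cube
  show a: "a = a'" using assms[of 1 0 0] by simp
  show g: "g = g'" using assms[of 0 1 0] by simp
  show m: "m = m'" using assms[of 0 0 1] by simp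
  show b: "b = b'" and d: "d = d'" using assms[of "1/3" "2/3" 0] assms[of "2/3" "1/3" 0] a g by (simp_all add: field_simps)
  show c: "c = c'" and f: "f = f'" using assms[of "1/3" 0 "2/3"] assms[of "2/3" 0 "1/3"] a m by (simp_all add: field_simps)
  show k: "k = k'" and l: "l = l'" using assms[of 0 "1/3" "2/3"] assms[of 0 "2/3" "1/3"] g m by (simp_all add: field_simps)
  show "e = e'" using assms[of "1/3" "1/3" "1/3"] a b c d f g k l m by (simp add: field_simps)
qed

lemma net_unique:
  assumes h: "h > 0" and B: "piecewise h (patch B) (patch' B) q" and B': "piecewise h (patch B') (patch' B') q"
  shows "B = B'"
proof -
  have T: "cubic_form (B Vert i j) (B (Edge PP) i j) (B (Edge PZ) i j) (B (Edge NN) (i+1) (j+1)) (B Cen i j)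
      (B (Edge NZ) (i+1) j) (B Vert (i+1) (j+1)) (B (Edge ZN) (i+1) (j+1)) (B (Edge ZP) (i+1) j) (B Vert (i+1) j) x y z
    = cubic_form (B' Vert i j) (B' (Edge PP) i j) (B' (Edge PZ) i j) (B' (Edge NN) (i+1) (j+1)) (B' Cen i j)
      (B' (Edge NZ) (i+1) j) (B' Vert (i+1) (j+1)) (B' (Edge ZN) (i+1) (j+1)) (B' (Edge ZP) (i+1) j) (B' Vert (i+1) j) x y z"
    if "0 \<le> x" "0 \<le> y" "0 \<le> z" "x + y + z = 1" for i j x y z
  proof -
    have z: "z = 1 - x - y" and "0 \<le> y" "y \<le> 1 - x" "1 - x \<le> 1" using that by simp_all
    then have "patch B i j (1 - x) y = patch B' i j (1 - x) y"
      using piecewiseD(1)[OF B h, of y "1 - x" i j] piecewiseD(1)[OF B' h, of y "1 - x" i j] by linarith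
    then show ?thesis by (simp add: patch_def z)
  qed
  have T': "cubic_form (B Vert i (j+1)) (B (Edge PZ) i (j+1)) (B (Edge ZN) i (j+1)) (B (Edge NZ) (i+1) (j+1)) (B Cen' i j)
      (B (Edge ZP) i j) (B Vert (i+1) (j+1)) (B (Edge NN) (i+1) (j+1)) (B (Edge PP) i j) (B Vert i j) x y z
    = cubic_form (B' Vert i (j+1)) (B' (Edge PZ) i (j+1)) (B' (Edge ZN) i (j+1)) (B' (Edge NZ) (i+1) (j+1)) (B' Cen' i j)
      (B' (Edge ZP) i j) (B' Vert (i+1) (j+1)) (B' (Edge NN) (i+1) (j+1)) (B' (Edge PP) i j) (B' Vert i j) x y z"
    if "0 \<le> x" "0 \<le> y" "0 \<le> z" "x + y + z = 1" for i j x y z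
  proof -
    have x: "x = 1 - z - y" and "0 \<le> y" "y \<le> 1 - z" "1 - z \<le> 1" using that by simp_all
    then have "patch' B i j y (1 - z) = patch' B' i j y (1 - z)"
      using piecewiseD(2)[OF B h, of y "1 - z" i j] piecewiseD(2)[OF B' h, of y "1 - z" i j] by linarith
    then show ?thesis by (simp add: patch'_def x)
  qed
  have NN: "B (Edge NN) (i+1) (j+1) = B' (Edge NN) (i+1) (j+1)" for i j by (rule cubic_form_unique(4)[OF T])
  have ZN: "B (Edge ZN) (i+1) (j+1) = B' (Edge ZN) (i+1) (j+1)" for i j by (rule cubic_form_unique(8)[OF T])
  have NZ: "B (Edge NZ) (i+1) j = B' (Edge NZ) (i+1) j" for i j by (rule cubic_form_unique(6)[OF T])
  have ZP: "B (Edge ZP) (i+1) j = B' (Edge ZP) (i+1) j" for i j by (rule cubic_form_unique(9)[OF T])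
  have "B c i j = B' c i j" for c i j
  proof (cases c)
    case Vert
    have "B Vert i j = B' Vert i j" by (rule cubic_form_unique(1)[OF T])
    then show ?thesis using Vert by simp
  next
    case (Edge d)
    have "B (Edge PP) i j = B' (Edge PP) i j" by (rule cubic_form_unique(2)[OF T])
    moreover have "B (Edge PZ) i j = B' (Edge PZ) i j" by (rule cubic_form_unique(3)[OF T])
    ultimately show ?thesis
      using Edge NN[of "i-1" "j-1"] ZN[of "i-1" "j-1"]
        NZ[of "i-1" j] ZP[of "i-1" j]
      by (cases d) simp_all
  next
    case Cen
    have "B Cen i j = B' Cen i j" by (rule cubic_form_unique(5)[OF T])
    then show ?thesis using Cen by simp
  next
    case Cen'
    have "B Cen' i j = B' Cen' i j" by (rule cubic_form_unique(5)[OF T'])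
    then show ?thesis using Cen' by simp
  qed
  then show ?thesis by (intro ext)
qed

text \<open>Reproducing a quadratic means reproducing its net. At the vertex \<open>v\<^sub>0\<^sub>,\<^sub>0\<close> the basis quadratics
read off the single moments.\<close>

lemma exact_on_quadratics_iff:
  assumes h: "h > 0"
  shows "exact_on_quadratics h M \<longleftrightarrow> (\<forall>c. \<forall>n<6. moment M c n = blossom_moment c n)"
proof
  assume E: "exact_on_quadratics h M"
  have eq: "bb_coeff h M (lat_quad h a) = quad_net a" for a
  proof (rule net_unique[OF h])
    have "quasi_interp h M (lat_quad h a) = lat_quad h a"
      using E poly2_deg_le_2_iff[OF h] unfolding exact_on_quadratics_def by blast
    then show "piecewise h (patch (bb_coeff h M (lat_quad h a))) (patch' (bb_coeff h M (lat_quad h a))) (lat_quad h a)"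
      using is_quasi_interpolant_quasi_interp[OF h] is_quasi_interpolant_iff_piecewise[OF h] by metis
  qed (rule piecewise_quad_net[OF h])
  show "\<forall>c. \<forall>n<6. moment M c n = blossom_moment c n"
  proof (intro allI impI)
    fix c and n :: nat assume n: "n < 6"
    have e: "(\<Sum>m<6. taylor (\<lambda>m. if m = n then 1 else 0) 0 0 m * g m) = g n" for g
    proof -
      have "n \<in> {0, 1, 2, 3, 4, 5}" using n by auto
      then show ?thesis by (auto simp: sum_6 taylor_def quad_mono_def quad_mono_s_def quad_mono_t_def)
    qed
    show "moment M c n = blossom_moment c n"
      using fun_cong[OF fun_cong[OF fun_cong[OF eq[of "\<lambda>m. if m = n then 1 else 0"], of c], of 0], of 0]
      by (simp add: bb_coeff_lat_quad[OF h] quad_net_def e)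
  qed
next
  assume m: "\<forall>c. \<forall>n<6. moment M c n = blossom_moment c n"
  show "exact_on_quadratics h M"
    unfolding exact_on_quadratics_def
  proof (intro allI impI)
    fix p assume "poly2_deg_le 2 p"
    then obtain a where p: "p = lat_quad h a" using poly2_deg_le_2_iff[OF h] by blast
    have "bb_coeff h M p = quad_net a"
      using m by (simp add: fun_eq_iff p bb_coeff_lat_quad[OF h] quad_net_def)
    then have "is_quasi_interpolant h M p p"
      using is_quasi_interpolant_iff_piecewise[OF h] piecewise_quad_net[OF h, of a] p by simp
    then show "quasi_interp h M p = p"
      using ex1_quasi_interpolant[OF h] is_quasi_interpolant_quasi_interp[OF h] by blast
  qed
qed

section \<open>The four splines behind a column\<close>


definition vec7 :: "real \<Rightarrow> real \<Rightarrow> real \<Rightarrow> real \<Rightarrow> real \<Rightarrow> real \<Rightarrow> real \<Rightarrow> real ^ 7" where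
  "vec7 a0 a1 a2 a3 a4 a5 a6 = (\<chi> k. if k = 0 then a0 else if k = 1 then a1 else if k = 2 then a2
     else if k = 3 then a3 else if k = 4 then a4 else if k = 5 then a5 else a6)"

lemma vec7_nth [simp]:
  "vec7 a0 a1 a2 a3 a4 a5 a6 $ 0 = a0" "vec7 a0 a1 a2 a3 a4 a5 a6 $ 1 = a1"
  "vec7 a0 a1 a2 a3 a4 a5 a6 $ 2 = a2" "vec7 a0 a1 a2 a3 a4 a5 a6 $ 3 = a3"
  "vec7 a0 a1 a2 a3 a4 a5 a6 $ 4 = a4" "vec7 a0 a1 a2 a3 a4 a5 a6 $ 5 = a5"
  "vec7 a0 a1 a2 a3 a4 a5 a6 $ 6 = a6"
  using distinct_7 by (auto simp: vec7_def)

lemma vec7_eqI: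
  assumes "v $ 0 = a0" "v $ 1 = a1" "v $ 2 = a2" "v $ 3 = a3" "v $ 4 = a4" "v $ 5 = a5" "v $ 6 = a6"
  shows "v = vec7 a0 a1 a2 a3 a4 a5 a6"
proof -
  have "v $ k = vec7 a0 a1 a2 a3 a4 a5 a6 $ k" for k
  proof -
    have "k \<in> {0, 1, 2, 3, 4, 5, 6}" using UNIV_7 by blast
    then show ?thesis using assms by auto
  qed
  then show ?thesis by (simp add: vec_eq_iff)
qed

text \<open>Every triangle of the mesh carries a cubic \<open>C\<^sup>1\<close> spline with value 1 at its three corners and 0 at all
other vertices, whose central ordinates are 3 on the triangle, 1 on its three neighbours and 0 elsewhere. The weights
\<open>p\<close>, \<open>q\<close>, \<open>r\<close>, \<open>t\<close> belong to four triangles with a corner at the origin: \<open>tri' 0 (-1)\<close>, \<open>tri (-1) 0\<close>,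
\<open>tri 0 0\<close> and \<open>tri' 0 0\<close>, where the arguments are the lattice indices. The splines of the other two triangles at the origin, \<open>tri (-1) (-1)\<close> and
\<open>tri' (-1) (-1)\<close>, would need a nonzero central ordinate on \<open>tri' (-1) (-2)\<close> and \<open>tri (-2) (-1)\<close> respectively,
and the origin does not lie in the stencils of those triangles.\<close>

fun spline_masks :: "real \<Rightarrow> real \<Rightarrow> real \<Rightarrow> real \<Rightarrow> coefficient \<Rightarrow> real ^ 7" where
  "spline_masks p q r t Vert      = vec7 (p + q + r + t) 0 q (q + t) (r + t) (r + p) p"
| "spline_masks p q r t (Edge PZ) = vec7 (2*p + 2*r + t) 0 (2*q) (q + 2*t) r 0 p"
| "spline_masks p q r t (Edge NZ) = vec7 (2*q + t) 0 0 q (r + 2*t) (2*r + 2*p) p"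
| "spline_masks p q r t (Edge ZP) = vec7 (2*q + r + 2*t) 0 q 0 t (2*r + p) (2*p)"
| "spline_masks p q r t (Edge ZN) = vec7 (2*p + r) 0 q (2*q + 2*t) (2*r + t) p 0"
| "spline_masks p q r t (Edge PP) = vec7 (p + q + 2*r + 2*t) 0 (2*q) t 0 r (2*p)"
| "spline_masks p q r t (Edge NN) = vec7 (p + q) 0 0 (2*q + t) (2*r + 2*t) (r + 2*p) 0"
| "spline_masks p q r t Cen       = vec7 (p + 3*r + t) p (3*q + t) t 0 0 p"
| "spline_masks p q r t Cen'      = vec7 (q + r + 3*t) q q 0 0 r (3*p + r)"

text \<open>The data \<open>g\<close> are arbitrary: the ordinates are sums of translates of the four splines, and the relations hold
identically in the values of \<open>g\<close>.\<close>

lemma C1_net_spline_masks: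
  "C1_net (\<lambda>c i j. \<Sum>k\<in>UNIV. spline_masks p q r t c $ k * g (i + fst (offset k)) (j + snd (offset k)))"
  unfolding C1_net_def sum_7 by (simp add: algebra_simps)

text \<open>The end relations express four of the edge ordinates through the vertex ordinate and two others, and
the middle relations form a triangular system. It starts from relations in which all but one or two
of the ordinates involved fall outside the stencil and thus vanish, and each group of equations
below has the previous unknowns as input.\<close>

lemma C1_mask_net_imp_spline_masks:
  assumes N: "C1_net (mask_net v)"
  obtains p q r t where "v = spline_masks p q r t"
proof -
  note D = C1_netD[OF N]
  have E: "v (Edge PP) $ k = v (Edge PZ) $ k + v (Edge ZP) $ k - v Vert $ k"
    "v (Edge NZ) $ k = 2 * v Vert $ k - v (Edge PZ) $ k"
    "v (Edge ZN) $ k = 2 * v Vert $ k - v (Edge ZP) $ k"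
    "v (Edge NN) $ k = 3 * v Vert $ k - v (Edge PZ) $ k - v (Edge ZP) $ k" for k
  proof -
    have c: "mask_net v c (- fst (offset k)) (- snd (offset k)) = v c $ k" for c
    proof -
      have "k \<in> {0, 1, 2, 3, 4, 5, 6}" using UNIV_7 by blast
      then show ?thesis by (elim insertE emptyE) (simp_all add: mask_net_def sum_7)
    qed
    show "v (Edge PP) $ k = v (Edge PZ) $ k + v (Edge ZP) $ k - v Vert $ k"
    "v (Edge NZ) $ k = 2 * v Vert $ k - v (Edge PZ) $ k"
    "v (Edge ZN) $ k = 2 * v Vert $ k - v (Edge ZP) $ k"
    "v (Edge NN) $ k = 3 * v Vert $ k - v (Edge PZ) $ k - v (Edge ZP) $ k"
      using D[of "- fst (offset k)" "- snd (offset k)"] unfolding c by simp_all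
  qed
  have R: "mask_net v Cen i j + mask_net v Cen' i j = mask_net v (Edge PP) i j + mask_net v (Edge NN) (i+1) (j+1)"
     "mask_net v Cen i (j+1) + mask_net v Cen' i j = mask_net v (Edge PZ) i (j+1) + mask_net v (Edge NZ) (i+1) (j+1)"
     "mask_net v Cen i j + mask_net v Cen' (i+1) j = mask_net v (Edge ZP) (i+1) j + mask_net v (Edge ZN) (i+1) (j+1)" for i j
    using N unfolding C1_net_def by blast+
  note R1 = R(1)[unfolded mask_net_def sum_7] and R2 = R(2)[unfolded mask_net_def sum_7] and R3 = R(3)[unfolded mask_net_def sum_7]
  define p q r t where "p = v Vert $ 6" and "q = v Vert $ 2" and "r = v Cen' $ 5" and "t = v Cen $ 3"
  note F = p_def[symmetric] q_def[symmetric] r_def[symmetric] t_def[symmetric] E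
  have "v Cen' $ 3 = 0" "v Cen $ 5 = 0" "v Cen' $ 4 = 0" "v Cen $ 4 = 0"
    using R2[of 0 1] R3[of 1 0] R2[of 1 1] R3[of 1 1] by (simp_all add: F)
  note F = F this
  have "v (Edge PZ) $ 1 = 2 * v Vert $ 1" "v (Edge ZP) $ 1 = 2 * v Vert $ 1"
    using R2[of "-2" "-2"] R3[of "-2" "-2"] by (simp_all add: F)
  moreover from this have "v Vert $ 1 = 0"
    using R1[of "-2" "-2"] by (simp add: F)
  ultimately have "v (Edge PZ) $ 1 = 0" "v (Edge ZP) $ 1 = 0" "v Vert $ 1 = 0" by simp_all
  note F = F this
  have "v (Edge PZ) $ 2 = 2 * q" "v (Edge ZP) $ 6 = 2 * p" "v (Edge ZP) $ 3 = 0" "v (Edge PZ) $ 5 = 0"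
    using R2[of "-2" "-1"] R3[of "-1" "-2"] R3[of "-1" 1] R2[of 1 "-1"] by (simp_all add: F)
  note F = F this
  have "v (Edge ZP) $ 2 = q" "v (Edge PZ) $ 6 = p" "v (Edge ZP) $ 4 = t" "v (Edge PZ) $ 4 = r"
    using R1[of "-2" "-1"] R1[of "-1" "-2"] R3[of 0 1] R2[of 1 0] by (simp_all add: F)
  note F = F this
  have "v Cen' $ 2 = q" "v Cen $ 6 = p" "v Cen' $ 1 = q" "v Cen $ 1 = p" "v Vert $ 4 = r + t"
    using R3[of "-2" 0] R2[of 0 "-2"] R3[of "-2" "-1"] R2[of "-1" "-2"] R1[of 1 1] by (simp_all add: F)
  note F = F this
  have "v Vert $ 3 = q + t" "v (Edge PZ) $ 3 = q + 2 * t"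
    using R2[of "-1" 0] R1[of 0 1] by (simp_all add: F)
  note F = F this
  have "v Vert $ 5 = r + p" "v (Edge ZP) $ 5 = 2 * r + p"
    using R3[of 0 "-1"] R1[of 1 0] by (simp_all add: F)
  note F = F this
  have "v Cen' $ 0 = q + r + 3 * t" "v Cen $ 0 = p + 3 * r + t" "v Cen' $ 6 = 3 * p + r" "v Cen $ 2 = 3 * q + t"
    using R2[of 0 0] R3[of 0 0] R1[of 0 "-1"] R1[of "-1" 0] by (simp_all add: F)
  note F = F this
  have "v (Edge PZ) $ 0 = 2 * p + 2 * r + t" "v (Edge ZP) $ 0 = 2 * q + r + 2 * t"
    using R2[of 0 "-1"] R3[of "-1" 0] by (simp_all add: F)
  note F = F this
  have "v Vert $ 0 = p + q + r + t"
    using R2[of "-1" "-1"] by (simp add: F)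
  note F = F this
  have "v c = spline_masks p q r t c" for c
    by (cases "(p, q, r, t, c)" rule: spline_masks.cases) (simp_all, (rule vec7_eqI; simp add: F)+)
  then show ?thesis using that[of p q r t] by blast
qed

lemma C1_net_add: "C1_net B \<Longrightarrow> C1_net B' \<Longrightarrow> C1_net (\<lambda>c i j. B c i j + B' c i j)"
  unfolding C1_net_def by (simp add: algebra_simps)

text \<open>Necessity comes from the bumps, one column at a time; sufficiency because the net of any \<open>f\<close> is the sum of the contributions
of its three types of data.\<close>

lemma maps_to_splines_iff:
  assumes h: "h > 0"
  shows "maps_to_splines h M \<longleftrightarrow> (\<forall>J. \<exists>p q r t. \<forall>c. M $ (c, J) = spline_masks p q r t c)"
proof
  assume M: "maps_to_splines h M"
  show "\<forall>J. \<exists>p q r t. \<forall>c. M $ (c, J) = spline_masks p q r t c"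
  proof
    fix J
    obtain p q r t where "(\<lambda>c. M $ (c, J)) = spline_masks p q r t"
      using C1_mask_net_imp_spline_masks[OF C1_mask_net[OF h M]] by blast
    then show "\<exists>p q r t. \<forall>c. M $ (c, J) = spline_masks p q r t c"
      by metis
  qed
next
  assume M: "\<forall>J. \<exists>p q r t. \<forall>c. M $ (c, J) = spline_masks p q r t c"
  have N: "C1_net (\<lambda>c i j. \<Sum>k\<in>UNIV. M $ (c, J) $ k * g (i + fst (offset k)) (j + snd (offset k)))" for J g
  proof -
    obtain p q r t where "\<And>c. M $ (c, J) = spline_masks p q r t c" using M by blast
    then show ?thesis using C1_net_spline_masks by simp
  qed
  have "C1_net (bb_coeff h M f)" for f
    unfolding bb_coeff_offset[abs_def] by (intro C1_net_add N[of _ "\<lambda>i j. g (vtx h i j)" for g])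
  then show "maps_to_splines h M"
    unfolding maps_to_splines_def using quasi_interp_spline_iff[OF h] by blast
qed

section \<open>The five-parameter family\<close>

text \<open>The weights \<open>(p, q, r, t)\<close> of each column for a solution with parameters \<open>(a, b, c, d, e)\<close>. For \<open>\<kappa> = 1\<close> they solve
the moment equations, for \<open>\<kappa> = 0\<close> the homogeneous ones, and they are jointly linear in \<open>\<kappa>\<close> and the
parameters. The parameters are fractions of the weights \<open>r\<close>, \<open>t\<close> of the
value column and of the lattice-derivative combinations of the others, as in \<open>solution_of_moments\<close>, chosen so
that they enter with integer coefficients.\<close>

fun solution_weights :: "real \<Rightarrow> real \<times> real \<times> real \<times> real \<times> real \<Rightarrow> jet \<Rightarrow> real \<times> real \<times> real \<times> real" where
  "solution_weights \<kappa> (a, b, c, d, e) J00 = (\<kappa>/6 - 4*b, \<kappa>/6 - 2*a, 2*a, 4*b)"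
| "solution_weights \<kappa> (a, b, c, d, e) J10 =
    (c + 3*d + 4*e - 2*b - \<kappa>/6, - c - 3*d - 4*e + a + 4*b + \<kappa>/18, - 2*c - 2*e + a + 2*b + \<kappa>/9, 2*c + 2*e)"
| "solution_weights \<kappa> (a, b, c, d, e) J01 =
    (c + 3*d + 2*e - 4*b, - c + d + 2*e + a - 2*b - \<kappa>/9, - 2*c - 4*d - 2*e + a + 2*b + \<kappa>/9, 2*c - 2*e)"

definition solution :: "real \<Rightarrow> real \<times> real \<times> real \<times> real \<times> real \<Rightarrow> masks" where
  "solution \<kappa> x = (\<chi> cJ. case solution_weights \<kappa> x (snd cJ) of (p, q, r, t) \<Rightarrow> spline_masks p q r t (fst cJ))"

lemma moment_eqs:
  fixes M :: masks
  defines "f \<equiv> \<lambda>c k. M $ (c, J00) $ k" and "x \<equiv> \<lambda>c k. M $ (c, J10) $ k" and "y \<equiv> \<lambda>c k. M $ (c, J01) $ k"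
  shows "moment M c 0 = f c 0 + f c 1 + f c 2 + f c 3 + f c 4 + f c 5 + f c 6"
    "moment M c (Suc 0) = f c 1 + f c 2 - f c 4 - f c 5 + (x c 0 + x c 1 + x c 2 + x c 3 + x c 4 + x c 5 + x c 6
       + y c 0 + y c 1 + y c 2 + y c 3 + y c 4 + y c 5 + y c 6) / 2"
    "moment M c 2 = f c 1 - f c 3 - f c 4 + f c 6 + (x c 0 + x c 1 + x c 2 + x c 3 + x c 4 + x c 5 + x c 6
       - y c 0 - y c 1 - y c 2 - y c 3 - y c 4 - y c 5 - y c 6) / 2"
    "moment M c 3 = f c 1 + f c 2 + f c 4 + f c 5 + x c 1 + x c 2 - x c 4 - x c 5 + y c 1 + y c 2 - y c 4 - y c 5"
    "moment M c 4 = f c 1 + f c 4 + x c 1 - x c 4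
       + (x c 2 - x c 3 - x c 5 + x c 6 - y c 2 - y c 3 + y c 5 + y c 6) / 2"
    "moment M c 5 = f c 1 + f c 3 + f c 4 + f c 6 + x c 1 - x c 3 - x c 4 + x c 6 - y c 1 + y c 3 + y c 4 - y c 6"
  by (simp_all add: moment_def sum_7 quad_mono_def quad_mono_s_def quad_mono_t_def f_def x_def y_def add_divide_distrib diff_divide_distrib)

lemma moments_solution: "n < 6 \<Longrightarrow> moment (solution 1 x) c n = blossom_moment c n"
proof -
  assume "n < 6"
  then have n: "n \<in> {0, 1, 2, 3, 4, 5}" by auto
  obtain a b e f g where x: "x = (a, b, e, f, g)" by (cases x)
  have "c \<in> {Vert, Edge PP, Edge PZ, Edge ZP, Edge NZ, Edge ZN, Edge NN, Cen, Cen'}"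
  proof (cases c)
    case (Edge d) then show ?thesis by (cases d) simp_all
  qed simp_all
  then show ?thesis
    using n unfolding x
    by (elim insertE emptyE)
       (simp_all add: moment_eqs solution_def blossom_moment_def field_simps)
qed

text \<open>Seven independent moment equations already determine seven of the twelve weights. Half the sum and half the difference of
the two derivative columns, \<open>A\<close> and \<open>B\<close>, are the columns for the lattice derivatives; in these the equations
are almost separated, and only the mixed moment of the vertex functional couples \<open>A\<close> with \<open>B\<close>.\<close>

lemma solution_of_moments:
  assumes M: "\<And>c J. M $ (c, J) = spline_masks (p J) (q J) (r J) (t J) c"
    and m: "\<And>c n. n < 6 \<Longrightarrow> moment M c n = blossom_moment c n"
  shows "M = solution 1 (r J00 / 2, t J00 / 4, (t J10 + t J01) / 4, (r J10 - r J01) / 4, (t J10 - t J01) / 4)"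
proof -
  note S = moment_eqs M blossom_moment_def
  have V: "3 * p J00 + 3 * q J00 + 3 * r J00 + 3 * t J00 = 1"
    using m[of 0 Vert] by (simp add: S)
  have s: "moment M Vert 1 = 0" "moment M (Edge ZP) 4 = moment M Vert 4" "moment M (Edge PZ) 4 = moment M Vert 4"
     "moment M Cen' 3 = 0" "moment M Cen 5 = 0" "moment M Vert 4 = 0"
    by (simp_all add: m blossom_moment_def)
  define A where "A g = (g J10 + g J01) / 2" for g :: "jet \<Rightarrow> real"
  define B where "B g = (g J10 - g J01) / 2" for g :: "jet \<Rightarrow> real"
  have AB: "g J10 = A g + B g" "g J01 = A g - B g" for g by (simp_all add: A_def B_def field_simps)
  note S = S AB[of p] AB[of q] AB[of r] AB[of t]
  have e1: "- p J00 + q J00 - 2 * r J00 - t J00 + 3 * (A p + A q + A r + A t) = 0"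
    using s(1) by (simp add: S add_divide_distrib algebra_simps)
  have e2: "A p + A q + A r + A t = r J00"
    using s(2) by (simp add: S field_simps)
  have e3: "B p + B q + B r + B t = t J00"
    using s(3) by (simp add: S field_simps)
  have e4: "2 * q J00 + r J00 + 4 * A q - 2 * A r = 0"
    using s(4) by (simp add: S)
  have e5: "2 * p J00 + t J00 + 4 * B p - 2 * B t = 0"
    using s(5) by (simp add: S)
  have e6: "r J00 + t J00 + A p - A q - A r - 2 * A t - B p + B q - 2 * B r - B t = 0"
    using s(6) by (simp add: S field_simps)
  have p: "p J00 = 1/6 - t J00" and q: "q J00 = 1/6 - r J00"
    using V e1 unfolding e2 by simp_all
  have P: "A q = - (A t / 2) - B r / 2 - B t / 2 + r J00 / 2 + t J00 / 4 - 1/36"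
    "A p = A t / 2 + 3/2 * B r + 3/2 * B t - 3/4 * t J00 - 1/12"
    "A r = - A t - B r - B t + r J00 / 2 + t J00 / 2 + 1/9"
    "B p = B t / 2 + t J00 / 4 - 1/12" "B q = - B r - 3/2 * B t + 3/4 * t J00 + 1/12"
    using p q e2 e3 e4 e5 e6 by linarith+
  note P = p q P
  have "M $ (c, J) = solution 1 (r J00 / 2, t J00 / 4, A t / 2, B r / 2, B t / 2) $ (c, J)" for c J
    unfolding M solution_def
    by (cases J; simp add: AB[of p] AB[of q] AB[of r] AB[of t] P; rule arg_cong2[of _ _ _ _ "\<lambda>f c. f c"] refl; simp add: algebra_simps)
  then show ?thesis by (simp add: vec_eq_iff A_def B_def)
qed

lemma vec7_linear:
  "vec7 a0 a1 a2 a3 a4 a5 a6 + vec7 b0 b1 b2 b3 b4 b5 b6 = vec7 (a0+b0) (a1+b1) (a2+b2) (a3+b3) (a4+b4) (a5+b5) (a6+b6)"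
  "k *\<^sub>R vec7 a0 a1 a2 a3 a4 a5 a6 = vec7 (k*a0) (k*a1) (k*a2) (k*a3) (k*a4) (k*a5) (k*a6)"
  by (simp_all add: vec7_def vec_eq_iff)

lemma spline_masks_linear:
  "spline_masks p q r t c + spline_masks p' q' r' t' c = spline_masks (p + p') (q + q') (r + r') (t + t') c"
  "k *\<^sub>R spline_masks p q r t c = spline_masks (k * p) (k * q) (k * r) (k * t) c"
  by (cases "(p, q, r, t, c)" rule: spline_masks.cases; simp add: vec7_linear algebra_simps)+

lemma solution_linear:
  "solution \<kappa> x + solution \<kappa>' x' = solution (\<kappa> + \<kappa>') (x + x')"
  "k *\<^sub>R solution \<kappa> x = solution (k * \<kappa>) (k *\<^sub>R x)"
proof -
  obtain a b c d e where x: "x = (a, b, c, d, e)" by (cases x)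
  obtain a' b' c' d' e' where x': "x' = (a', b', c', d', e')" by (cases x')
  have "(solution \<kappa> x + solution \<kappa>' x') $ (C, J) = solution (\<kappa> + \<kappa>') (x + x') $ (C, J)"
    "(k *\<^sub>R solution \<kappa> x) $ (C, J) = solution (k * \<kappa>) (k *\<^sub>R x) $ (C, J)" for C J
    by (cases J; simp add: solution_def x x' spline_masks_linear; simp add: algebra_simps add_divide_distrib)+
  then show "solution \<kappa> x + solution \<kappa>' x' = solution (\<kappa> + \<kappa>') (x + x')"
    "k *\<^sub>R solution \<kappa> x = solution (k * \<kappa>) (k *\<^sub>R x)"
    by (simp_all add: vec_eq_iff)
qed

lemma inj_solution: "inj (solution 0)"
proof (rule injI)
  fix x y assume eq: "solution 0 x = solution 0 y"
  obtain a b c d e where x: "x = (a, b, c, d, e)" by (cases x)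
  obtain a' b' c' d' e' where y: "y = (a', b', c', d', e')" by (cases y)
  have E: "solution 0 x $ (C, J) $ k = solution 0 y $ (C, J) $ k" for C J k using eq by simp
  \<comment> \<open>These mask entries are single weights \<open>q\<close>, \<open>p\<close>, \<open>t\<close>, \<open>r\<close>, and together they determine the parameters.\<close>
  show "x = y"
    using E[of Vert J00 2] E[of Vert J00 6] E[of Cen J10 3] E[of Cen J01 3] E[of Cen' J10 5] E[of Cen' J01 5]
    by (simp add: x y solution_def)
qed

theorem proposition2:
  fixes h :: real
  assumes "h > 0"
  shows "affine {M :: masks. maps_to_splines h M \<and> exact_on_quadratics h M} \<and>
         aff_dim {M :: masks. maps_to_splines h M \<and> exact_on_quadratics h M} = 5"
proof -
  have "maps_to_splines h M \<and> exact_on_quadratics h M \<longleftrightarrow> M \<in> range (solution 1)" for M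
  proof
    assume "maps_to_splines h M \<and> exact_on_quadratics h M"
    then have M: "\<forall>J. \<exists>p q r t. \<forall>c. M $ (c, J) = spline_masks p q r t c"
      and m: "\<forall>c. \<forall>n<6. moment M c n = blossom_moment c n"
      using maps_to_splines_iff[OF assms] exact_on_quadratics_iff[OF assms] by blast+
    obtain p q r t where "\<And>c J. M $ (c, J) = spline_masks (p J) (q J) (r J) (t J) c"
      using M by metis
    from solution_of_moments[OF this] m show "M \<in> range (solution 1)" by blast
  next
    assume "M \<in> range (solution 1)"
    then obtain x where M: "M = solution 1 x" by blast
    have "\<exists>p q r t. \<forall>c. M $ (c, J) = spline_masks p q r t c" for J
      by (cases "solution_weights 1 x J") (auto simp: M solution_def)
    moreover have "\<forall>c. \<forall>n<6. moment M c n = blossom_moment c n"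
      by (simp add: M moments_solution)
    ultimately show "maps_to_splines h M \<and> exact_on_quadratics h M"
      using maps_to_splines_iff[OF assms] exact_on_quadratics_iff[OF assms] by blast
  qed
  then have eq: "{M :: masks. maps_to_splines h M \<and> exact_on_quadratics h M}
      = (+) (solution 1 0) ` range (solution 0)"
    using solution_linear(1)[of 1 0 0] by (auto simp: image_image)
  have lin: "linear (solution 0)"
    by (rule linearI) (simp_all add: solution_linear)
  then have "affine (range (solution 0))"
    by (intro subspace_imp_affine linear_subspace_image lin) simp_all
  moreover have "aff_dim (range (solution 0)) = 5"
    using aff_dim_injective_linear_image[OF lin inj_solution, of UNIV] by simp
  ultimately show ?thesis
    unfolding eq affine_translation[symmetric] aff_dim_translation_eq by blast
qed

end
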